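(* Let $X$ be a real separable Banach space and $\gamma$ a centered Gaussian measure on $(X,\mathcal{B}(X))$ whose Cameron-Martin space $H(\gamma)$ is infinite-dimensional. Let $(\lambda_n)_{n\ge0}$ and $(x_n)_{n\ge0}$ be sequences produced by the iterative decomposition of $\gamma$ described in the context. Then the covariance operator of $\gamma$ can be decomposed as $$R_\gamma=\sum_{n\ge0}\lambda_n\langle x_n,\cdot\rangle_{X,X^*}\,x_n,$$ where the convergence is in $\mathcal{L}(X^*,X)$. More precisely, for every $n\ge0$ the $n$-th step truncation error is $$\Big\lVert R_\gamma-\sum_{k=0}^n\lambda_k\langle x_k,\cdot\rangle_{X,X^*}\,x_k\Big\rVert=\lambda_{n+1},$$ where $\lVert\cdot\rVert$ is the operator norm in $\mathcal{L}(X^*,X)$.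
   Context: $X^*$ is the topological dual of $X$ with its dual norm, $\langle x,f\rangle_{X,X^*}=f(x)$ is the duality pairing, $B_{X^*}$ is the closed unit ball of $X^*$, $\mathcal{B}(X)$ is the Borel $\sigma$-algebra, and $\mathcal{L}(X^*,X)$ is the space of bounded linear operators from $X^*$ to $X$. A probability measure $\gamma$ on $(X,\mathcal{B}(X))$ is a centered Gaussian measure if for every $f\in X^*$ the pushforward $\gamma\circ f^{-1}$ is a centered (possibly degenerate) Gaussian measure on $\mathbb{R}$. Its covariance operator is $R_\gamma:X^*\to X$, $R_\gamma f=\int_X\langle x,f\rangle_{X,X^*}\,x\,\gamma(dx)$ (Bochner integral). The Cameron-Martin space $H(\gamma)$ is the Hilbertian subspace of $X$ with kernel $R_\gamma$: the unique linear subspace of $X$ equipped with a Hilbert inner product $\langle\cdot,\cdot\rangle_\gamma$ which is continuously embedded in $X$, contains $R_\gamma(X^* )$ (as a dense subset), and satisfies $\langle h,f\rangle_{X,X^*}=\langle h,R_\gamma f\rangle_\gamma$ for all $h\in H(\gamma)$, $f\in X^*$. Iterative decomposition of $\gamma$: put $\gamma_0=\gamma$. Given the centered Gaussian measure $\gamma_n$ on $X$, let $\lambda_n=\max_{f\in B_{X^*}}\langle R_{\gamma_n}f,f\rangle_{X,X^*}$ (the maximum is attained), choose any $f_n\in B_{X^*}$ with $\lVert f_n\rVert_{X^*}=1$ and $\langle R_{\gamma_n}f_n,f_n\rangle_{X,X^*}=\lambda_n$, define $x_n\in X$ by $R_{\gamma_n}f_n=\lambda_nx_n$, and let $\gamma_{n+1}$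 be the image (pushforward) of $\gamma_n$ under $x\mapsto x-\langle x,f_n\rangle_{X,X^*}x_n$, i.e. the centered Gaussian measure with covariance operator $R_{\gamma_{n+1}}=R_{\gamma_n}-\lambda_n\langle x_n,\cdot\rangle_{X,X^*}x_n$. When $H(\gamma)$ is infinite-dimensional, $\lambda_n>0$ for all $n$ and the construction never stops. *)

theory Defs
  imports "HOL-Probability.Probability"
begin

definition centered_gaussian_real :: "real measure \<Rightarrow> bool" where
  "centered_gaussian_real \<nu> \<longleftrightarrow>
     \<nu> = return borel 0 \<or> (\<exists>\<sigma>>0. \<nu> = density lborel (normal_density 0 \<sigma>))"

definition centered_gaussian :: "'a::real_normed_vector measure \<Rightarrow> bool" where
  "centered_gaussian \<gamma> \<longleftrightarrow>
     sets \<gamma> = sets borel \<and> prob_space \<gamma> \<and>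
     (\<forall>f :: 'a \<Rightarrow>\<^sub>L real. centered_gaussian_real (distr \<gamma> borel (blinfun_apply f)))"

text \<open>
  For a Gaussian measure the second moment of the norm is finite (Fernique), so the
  Bochner integral below converges and depends boundedly on \<open>f\<close>; see
  \<open>covariance_operator_apply\<close>. Without such integrability the value of
  \<open>Blinfun\<close> is unspecified.
\<close>

definition covariance_operator ::
    "'a::{banach, second_countable_topology} measure \<Rightarrow> ('a \<Rightarrow>\<^sub>L real) \<Rightarrow>\<^sub>L 'a" where
  "covariance_operator \<gamma> =
     Blinfun (\<lambda>f. \<integral>x. blinfun_apply f x *\<^sub>R x \<partial>\<gamma>)"

lemma covariance_operator_apply:
  fixes \<gamma> :: "'a::{banach, second_countable_topology} measure"
  assumes sets: "sets \<gamma> = sets borel" and int: "integrable \<gamma> (\<lambda>x. (norm x)\<^sup>2)"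
  shows "blinfun_apply (covariance_operator \<gamma>) f = (\<integral>x. blinfun_apply f x *\<^sub>R x \<partial>\<gamma>)"
proof -
  have bound: "norm (blinfun_apply g x *\<^sub>R x) \<le> norm g * (norm x)\<^sup>2"
    for g :: "'a \<Rightarrow>\<^sub>L real" and x
    using mult_right_mono[OF norm_blinfun[of g x], of "norm x"]
    by (simp add: power2_eq_square mult.assoc)
  have meas: "(\<lambda>x. blinfun_apply g x *\<^sub>R x) \<in> borel_measurable \<gamma>" for g :: "'a \<Rightarrow>\<^sub>L real"
    unfolding measurable_cong_sets[OF sets refl]
    by (intro borel_measurable_continuous_onI continuous_intros)
  have integ: "integrable \<gamma> (\<lambda>x. blinfun_apply g x *\<^sub>R x)" for g :: "'a \<Rightarrow>\<^sub>L real"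
    by (rule Bochner_Integration.integrable_bound[OF integrable_mult_right[OF int, of "norm g"] meas])
       (use bound in auto)
  have "bounded_linear (\<lambda>g :: 'a \<Rightarrow>\<^sub>L real. \<integral>x. blinfun_apply g x *\<^sub>R x \<partial>\<gamma>)"
  proof (rule bounded_linear_intro[where K = "\<integral>x. (norm x)\<^sup>2 \<partial>\<gamma>"])
    fix g h :: "'a \<Rightarrow>\<^sub>L real" and r :: real
    show "(\<integral>x. blinfun_apply (g + h) x *\<^sub>R x \<partial>\<gamma>) =
        (\<integral>x. blinfun_apply g x *\<^sub>R x \<partial>\<gamma>) + (\<integral>x. blinfun_apply h x *\<^sub>R x \<partial>\<gamma>)"
      by (simp add: blinfun.add_left scaleR_add_left integ)
    show "(\<integral>x. blinfun_apply (r *\<^sub>R g) x *\<^sub>R x \<partial>\<gamma>) = r *\<^sub>R (\<integral>x. blinfun_apply g x *\<^sub>R x \<partial>\<gamma>)"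
      by (simp add: blinfun.scaleR_left flip: scaleR_scaleR)
    have "norm (\<integral>x. blinfun_apply g x *\<^sub>R x \<partial>\<gamma>) \<le> (\<integral>x. norm g * (norm x)\<^sup>2 \<partial>\<gamma>)"
      by (intro order_trans[OF integral_norm_bound] integral_mono integrable_norm integ integrable_mult_right int bound)
    then show "norm (\<integral>x. blinfun_apply g x *\<^sub>R x \<partial>\<gamma>) \<le> norm g * (\<integral>x. (norm x)\<^sup>2 \<partial>\<gamma>)"
      by simp
  qed
  then show ?thesis
    by (simp add: covariance_operator_def bounded_linear_Blinfun_apply)
qed

definition rank_one_operator :: "'a::real_normed_vector \<Rightarrow> ('a \<Rightarrow>\<^sub>L real) \<Rightarrow>\<^sub>L 'a" where
  "rank_one_operator x = Blinfun (\<lambda>f. blinfun_apply f x *\<^sub>R x)"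

lemma rank_one_operator_apply [simp]:
  "blinfun_apply (rank_one_operator x) f = blinfun_apply f x *\<^sub>R x"
  unfolding rank_one_operator_def
  by (subst bounded_linear_Blinfun_apply) (auto intro!: bounded_linear_intros)

text \<open>A Hilbert inner product on a subspace \<open>H\<close>; \<open>ip\<close> is irrelevant outside \<open>H\<close>.\<close>

definition hilbert_inner_product_on ::
    "'a::real_vector set \<Rightarrow> ('a \<Rightarrow> 'a \<Rightarrow> real) \<Rightarrow> bool" where
  "hilbert_inner_product_on H ip \<longleftrightarrow>
     subspace H \<and>
     (\<forall>u\<in>H. \<forall>v\<in>H. ip u v = ip v u) \<and>
     (\<forall>u\<in>H. \<forall>v\<in>H. \<forall>w\<in>H. ip (u + v) w = ip u w + ip v w) \<and>
     (\<forall>c. \<forall>u\<in>H. \<forall>v\<in>H. ip (c *\<^sub>R u) v = c * ip u v) \<and>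
     (\<forall>u\<in>H. u \<noteq> 0 \<longrightarrow> 0 < ip u u) \<and>
     (\<forall>s :: nat \<Rightarrow> 'a.
        (\<forall>n. s n \<in> H) \<and>
        (\<forall>e>0. \<exists>N. \<forall>m\<ge>N. \<forall>n\<ge>N. sqrt (ip (s m - s n) (s m - s n)) < e) \<longrightarrow>
        (\<exists>h\<in>H. (\<lambda>n. sqrt (ip (s n - h) (s n - h))) \<longlonglongrightarrow> 0))"

definition cameron_martin_space ::
    "'a::{banach, second_countable_topology} measure \<Rightarrow> 'a set \<Rightarrow> ('a \<Rightarrow> 'a \<Rightarrow> real) \<Rightarrow> bool" where
  "cameron_martin_space \<gamma> H ip \<longleftrightarrow>
     hilbert_inner_product_on H ip \<and>
     (\<exists>C. \<forall>h\<in>H. norm h \<le> C * sqrt (ip h h)) \<and>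
     range (blinfun_apply (covariance_operator \<gamma>)) \<subseteq> H \<and>
     (\<forall>h\<in>H. \<forall>e>0. \<exists>f. let d = h - blinfun_apply (covariance_operator \<gamma>) f
                      in sqrt (ip d d) < e) \<and>
     (\<forall>h\<in>H. \<forall>f. blinfun_apply f h = ip h (blinfun_apply (covariance_operator \<gamma>) f))"

text \<open>
  The first three conditions at step \<open>n\<close> say that \<open>l n\<close> is the maximum of the quadratic
  form of \<open>\<Gamma> n\<close> over the closed dual unit ball, attained at the unit functional \<open>f n\<close>.
\<close>

definition iterative_decomposition ::
    "'a::{banach, second_countable_topology} measure \<Rightarrow> (nat \<Rightarrow> 'a measure) \<Rightarrow>
     (nat \<Rightarrow> real) \<Rightarrow> (nat \<Rightarrow> 'a \<Rightarrow>\<^sub>L real) \<Rightarrow> (nat \<Rightarrow> 'a) \<Rightarrow> bool" where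
  "iterative_decomposition \<gamma> \<Gamma> l f x \<longleftrightarrow>
     \<Gamma> 0 = \<gamma> \<and>
     (\<forall>n. (\<forall>g\<in>cball 0 1.
             blinfun_apply g (blinfun_apply (covariance_operator (\<Gamma> n)) g) \<le> l n) \<and>
          norm (f n) = 1 \<and>
          blinfun_apply (f n) (blinfun_apply (covariance_operator (\<Gamma> n)) (f n)) = l n \<and>
          blinfun_apply (covariance_operator (\<Gamma> n)) (f n) = l n *\<^sub>R x n \<and>
          \<Gamma> (Suc n) = distr (\<Gamma> n) borel (\<lambda>y. y - blinfun_apply (f n) y *\<^sub>R x n))"

end

theory Submission
  imports Defs "HOL-Complex_Analysis.Great_Picard"
begin

text \<open>
  Write \<open>R n\<close> for the covariance operator of \<open>\<Gamma> n\<close>. One step of the decomposition subtracts exactly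
  \<open>l n *\<^sub>R rank_one_operator (x n)\<close> from \<open>R n\<close> (\<open>covariance_operator_deflate\<close>), so \<open>R n\<close> is the
  remainder of the series after \<open>n\<close> terms. Since \<open>R n\<close> is symmetric and positive semidefinite, its
  operator norm is the maximum \<open>l n\<close> of its quadratic form (\<open>norm_covariance_operator_eqI\<close>). This is
  the error formula, and convergence of the series amounts to \<open>l n \<longlonglongrightarrow> 0\<close>.
  
  The operators decrease as quadratic forms, so \<open>l\<close> decreases, and \<open>R m\<close> annihilates \<open>f n\<close> for
  \<open>n < m\<close>. Consequently \<open>l m\<close> is the value of the form of \<open>R m\<close> at \<open>f m - f n\<close>, which is at most
  the squared distance of \<open>f m\<close> and \<open>f n\<close> in \<open>L\<^sup>2(\<gamma>)\<close>. If \<open>l\<close> stayed above some \<open>e > 0\<close>, the unit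
  functionals \<open>f n\<close> would be separated in \<open>L\<^sup>2(\<gamma>)\<close>. That is impossible: a subsequence converges
  pointwise, hence in \<open>L\<^sup>2(\<gamma>)\<close> by dominated convergence (\<open>unit_functionals_not_L2_separated\<close>).
  
  Two facts from functional analysis and Gaussian measure theory carry this argument. Norming
  functionals (Hahn-Banach) link the operator norm with the quadratic form and show that
  functionals generate the Borel sets of a separable space. The squared norm is
  \<open>\<gamma>\<close>-integrable (Fernique, \<open>gaussian_integrable_norm_squared\<close>), which makes the covariance
  integral converge and provides the dominating function. Fernique's argument rests on the invariance of
  the product of two copies of \<open>\<gamma>\<close> under rotation by 45 degrees, which follows from the uniqueness
  theorem for characteristic functionals (\<open>char_functional_unique\<close>).
\<close>

section \<open>Norming functionals\<close>

definition sublinear :: "('a::real_vector \<Rightarrow> real) \<Rightarrow> bool" where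
  "sublinear p \<longleftrightarrow> (\<forall>x y. p (x + y) \<le> p x + p y) \<and> (\<forall>c\<ge>0. \<forall>x. p (c *\<^sub>R x) = c * p x)"

lemma sublinearI:
  assumes add: "\<And>x y. p (x + y) \<le> p x + p y"
    and scale: "\<And>c x. c > 0 \<Longrightarrow> p (c *\<^sub>R x) \<le> c * p x"
    and zero: "p 0 = 0"
  shows "sublinear p"
  unfolding sublinear_def
proof (intro conjI allI impI add)
  fix c :: real and x assume "c \<ge> 0"
  show "p (c *\<^sub>R x) = c * p x"
  proof (cases "c = 0")
    case False
    then have "c > 0" using \<open>c \<ge> 0\<close> by simp
    have "p x = p ((1/c) *\<^sub>R (c *\<^sub>R x))" using False by simp
    also have "\<dots> \<le> (1/c) * p (c *\<^sub>R x)" using \<open>c > 0\<close> by (intro scale) simp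
    finally have "c * p x \<le> p (c *\<^sub>R x)" using \<open>c > 0\<close> by (simp add: field_simps)
    with scale[OF \<open>c > 0\<close>, of x] show ?thesis by simp
  qed (simp add: zero)
qed

lemma sublinear_add: "sublinear p \<Longrightarrow> p (x + y) \<le> p x + p y"
  and sublinear_scale: "sublinear p \<Longrightarrow> c \<ge> 0 \<Longrightarrow> p (c *\<^sub>R x) = c * p x"
  by (auto simp: sublinear_def)

lemma sublinear_zero: "sublinear p \<Longrightarrow> p 0 = 0"
  using sublinear_scale[of p 0 0] by simp

lemma sublinear_minus: "sublinear p \<Longrightarrow> - p (- x) \<le> p x"
  using sublinear_add[of p x "- x"] by (simp add: sublinear_zero)

text \<open>
  A sublinear functional that is not odd at \<open>z\<close> can be lowered: the largest sublinear functional
  below \<open>p\<close> whose value at \<open>- z\<close> is at most \<open>- p z\<close> is the infimum of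
  \<open>p (y + t *\<^sub>R z) - t * p z\<close> over \<open>t \<ge> 0\<close>. The lemma is used twice below: to see that minimal
  sublinear functionals are linear, and to force the value of a linear minorant at a given point.
\<close>

lemma sublinear_lower:
  assumes p: "sublinear p"
  obtains q where "sublinear q" "\<And>y. q y \<le> p y" "q (- z) \<le> - p z"
proof -
  define F where "F y t = p (y + t *\<^sub>R z) - t * p z" for y t
  define q where "q y = (INF t\<in>{0..}. F y t)" for y
  have F_ge: "- p (- y) \<le> F y t" if "t \<ge> 0" for y t
  proof -
    have "t * p z = p ((y + t *\<^sub>R z) + (- y))" using that by (simp add: sublinear_scale[OF p])
    also have "\<dots> \<le> p (y + t *\<^sub>R z) + p (- y)" by (rule sublinear_add[OF p])
    finally show ?thesis by (simp add: F_def)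
  qed
  have q_le: "q y \<le> F y t" if "t \<ge> 0" for y t
    unfolding q_def using that F_ge by (intro cINF_lower bdd_belowI2) auto
  have q_ge: "a \<le> q y" if "\<And>t. t \<ge> 0 \<Longrightarrow> a \<le> F y t" for y a
    unfolding q_def using that by (intro cINF_greatest) auto
  have "sublinear q"
  proof (rule sublinearI)
    fix x y
    have "q (x + y) \<le> F x s + F y t" if "s \<ge> 0" "t \<ge> 0" for s t
    proof -
      have "q (x + y) \<le> F (x + y) (s + t)" using that by (intro q_le) simp
      also have "\<dots> \<le> F x s + F y t"
        using sublinear_add[OF p, of "x + s *\<^sub>R z" "y + t *\<^sub>R z"]
        by (simp add: F_def algebra_simps)
      finally show ?thesis .
    qed
    then have "q (x + y) - F x s \<le> q y" if "s \<ge> 0" for s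
      using that by (intro q_ge) (simp add: algebra_simps)
    then have "q (x + y) - q y \<le> q x"
      by (intro q_ge) (simp add: algebra_simps)
    then show "q (x + y) \<le> q x + q y" by simp
  next
    fix c :: real and x assume c: "c > 0"
    have "q (c *\<^sub>R x) / c \<le> q x"
    proof (rule q_ge)
      fix t :: real assume "t \<ge> 0"
      then have "q (c *\<^sub>R x) \<le> F (c *\<^sub>R x) (c * t)" using c by (intro q_le) simp
      also have "\<dots> = c * F x t"
        using sublinear_scale[OF p, of c "x + t *\<^sub>R z"] c by (simp add: F_def algebra_simps)
      finally show "q (c *\<^sub>R x) / c \<le> F x t" using c by (simp add: field_simps)
    qed
    then show "q (c *\<^sub>R x) \<le> c * q x" using c by (simp add: field_simps)
  next
    have "F 0 t = 0" if "t \<ge> 0" for t using that by (simp add: F_def sublinear_scale[OF p])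
    then show "q 0 = 0" using q_le[of 0 0] q_ge[of 0 0] by simp
  qed
  moreover have "q y \<le> p y" for y using q_le[of 0 y] by (simp add: F_def)
  moreover have "q (- z) \<le> - p z" using q_le[of 1 "- z"] by (simp add: F_def sublinear_zero[OF p])
  ultimately show thesis by (rule that)
qed

text \<open>
  Zorn's lemma for the reversed pointwise order. Every sublinear \<open>a \<le> p\<close> satisfies
  \<open>- p (- y) \<le> a y\<close>, so the pointwise infimum of a chain is finite; it is subadditive because of any two
  members of the chain one lies below both.
\<close>

lemma ex_minimal_sublinear:
  assumes p: "sublinear p"
  obtains q where "sublinear q" "\<And>y. q y \<le> p y"
    "\<And>r. sublinear r \<Longrightarrow> (\<And>y. r y \<le> q y) \<Longrightarrow> r = q"
proof -
  define A where "A = {q. sublinear q \<and> (\<forall>y. q y \<le> p y)}"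
  define P where "P = (\<lambda>a b :: 'a \<Rightarrow> real. \<forall>y. b y \<le> a y)"
  have ge: "- p (- y) \<le> a y" if "a \<in> A" for a y
    using sublinear_minus[of a y] that unfolding A_def by (smt (verit) mem_Collect_eq)
  have "\<exists>m\<in>A. \<forall>a\<in>A. P m a \<longrightarrow> a = m"
  proof (rule predicate_Zorn)
    show "partial_order_on A (relation_of P A)"
      by (rule partial_order_on_relation_ofI)
        (auto simp: P_def fun_eq_iff intro: order_trans antisym)
  next
    fix C assume "C \<in> Chains (relation_of P A)"
    then have CA: "C \<subseteq> A" and chain: "\<And>a b. a \<in> C \<Longrightarrow> b \<in> C \<Longrightarrow> P a b \<or> P b a"
      by (auto simp: Chains_def relation_of_def)
    show "\<exists>u\<in>A. \<forall>a\<in>C. P a u"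
    proof (cases "C = {}")
      case True
      then show ?thesis using p by (auto simp: A_def)
    next
      case False
      define u where "u y = (INF a\<in>C. a y)" for y
      have u_le: "u y \<le> a y" if "a \<in> C" for a y
        unfolding u_def using that ge CA
        by (intro cINF_lower bdd_belowI2[where m = "- p (- y)"]) auto
      have u_ge: "b \<le> u y" if "\<And>a. a \<in> C \<Longrightarrow> b \<le> a y" for b y
        unfolding u_def using that False by (intro cINF_greatest) auto
      have sub: "sublinear a" if "a \<in> C" for a using that CA by (auto simp: A_def)
      have "sublinear u"
      proof (rule sublinearI)
        fix x y
        have ab_le: "u (x + y) \<le> a x + b y" if ab: "a \<in> C" "b \<in> C" for a b
        proof -
          obtain c where c: "c \<in> C" "c x \<le> a x" "c y \<le> b y"
            using chain[OF ab] ab unfolding P_def by blast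
          then show ?thesis
            using u_le[OF c(1), of "x + y"] sublinear_add[OF sub[OF c(1)], of x y] by linarith
        qed
        have "u (x + y) - a x \<le> u y" if "a \<in> C" for a
          using ab_le[OF that] by (intro u_ge) (simp add: diff_le_eq add.commute)
        then have "u (x + y) - u y \<le> u x" by (intro u_ge) (simp add: algebra_simps)
        then show "u (x + y) \<le> u x + u y" by simp
      next
        fix c :: real and x assume c: "c > 0"
        have "u (c *\<^sub>R x) / c \<le> u x"
        proof (rule u_ge)
          fix a assume a: "a \<in> C"
          then show "u (c *\<^sub>R x) / c \<le> a x"
            using u_le[OF a, of "c *\<^sub>R x"] sublinear_scale[OF sub[OF a], of c x] c
            by (simp add: field_simps)
        qed
        then show "u (c *\<^sub>R x) \<le> c * u x" using c by (simp add: field_simps)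
      next
        show "u 0 = 0" using False by (simp add: u_def sublinear_zero[OF sub])
      qed
      moreover have "u y \<le> p y" for y
      proof -
        obtain a where "a \<in> C" using False by auto
        then show ?thesis using u_le[of a y] CA by (auto simp: A_def intro: order_trans)
      qed
      ultimately show ?thesis using u_le by (auto simp: A_def P_def)
    qed
  qed
  then obtain m where m: "m \<in> A" "\<And>a. a \<in> A \<Longrightarrow> P m a \<Longrightarrow> a = m" by blast
  show thesis
  proof (rule that[of m])
    fix r assume "sublinear r" "\<And>y. r y \<le> m y"
    then show "r = m" using m by (intro m(2)) (auto simp: A_def P_def intro: order_trans)
  qed (use m in \<open>auto simp: A_def\<close>)
qed

text \<open>
  A form of the Hahn-Banach theorem. By the lowering lemma a minimal sublinear functional is odd,
  and an odd sublinear functional is additive and homogeneous.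
\<close>

lemma ex_linear_le_sublinear:
  assumes "sublinear p"
  obtains h where "linear h" "\<And>y. h y \<le> p y"
proof -
  obtain q where q: "sublinear q" "\<And>y. q y \<le> p y"
    and min: "\<And>r. sublinear r \<Longrightarrow> (\<And>y. r y \<le> q y) \<Longrightarrow> r = q"
    using ex_minimal_sublinear[OF assms] by metis
  have odd: "q (- z) = - q z" for z
  proof -
    obtain r where r: "sublinear r" "\<And>y. r y \<le> q y" "r (- z) \<le> - q z"
      using sublinear_lower[OF q(1), of z] by metis
    then have "q (- z) \<le> - q z" using min[of r] by auto
    then show ?thesis using sublinear_minus[OF q(1), of z] by simp
  qed
  have "linear q"
  proof (rule linearI)
    fix x y
    have "q (x + y) \<ge> q x + q y"
      using sublinear_add[OF q(1), of "- x" "- y"] odd[of x] odd[of y] odd[of "x + y"] by simp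
    then show "q (x + y) = q x + q y" using sublinear_add[OF q(1), of x y] by simp
  next
    fix c :: real and x
    show "q (c *\<^sub>R x) = c *\<^sub>R q x"
    proof (cases "c \<ge> 0")
      case False
      then show ?thesis
        using sublinear_scale[OF q(1), of "- c" x] odd[of "c *\<^sub>R x"] by simp
    qed (simp add: sublinear_scale[OF q(1)])
  qed
  with q(2) show thesis by (rule that[rotated])
qed

text \<open>
  The norm is lowered to a sublinear \<open>q\<close> with \<open>q (- z) \<le> - norm z\<close>; every linear minorant of \<open>q\<close> then
  takes at \<open>z\<close> at least the value \<open>norm z\<close>.
\<close>

lemma ex_norming_functional:
  fixes z :: "'a::real_normed_vector"
  obtains h :: "'a \<Rightarrow>\<^sub>L real" where "norm h \<le> 1" "blinfun_apply h z = norm z"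
proof -
  have "sublinear (norm :: 'a \<Rightarrow> real)"
    by (rule sublinearI) (auto intro: norm_triangle_ineq)
  then obtain q where q: "sublinear q" "\<And>y. q y \<le> norm y" "q (- z) \<le> - norm z"
    using sublinear_lower[of norm z] by metis
  obtain h where h: "linear h" "\<And>y. h y \<le> q y" using ex_linear_le_sublinear[OF q(1)] by metis
  have le: "h y \<le> norm y" for y using h(2)[of y] q(2)[of y] by simp
  have minus: "h (- y) = - h y" for y using h(1) by (simp add: linear_neg)
  have abs: "norm (h y) \<le> norm y" for y using le[of y] le[of "- y"] minus[of y] by simp
  interpret bounded_linear h
    by (rule bounded_linear_intro[where K = 1])
      (use abs in \<open>auto simp: linear_add[OF h(1)] linear_cmul[OF h(1)]\<close>)
  have "norm (Blinfun h) \<le> 1"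
    by (rule norm_blinfun_bound) (use abs in \<open>auto simp: bounded_linear_Blinfun_apply bounded_linear_axioms\<close>)
  moreover have "blinfun_apply (Blinfun h) z = norm z"
    using h(2)[of "- z"] q(3) minus[of z] le[of z]
    by (simp add: bounded_linear_Blinfun_apply bounded_linear_axioms)
  ultimately show thesis by (rule that)
qed

section \<open>Uniqueness of characteristic functionals\<close>

text \<open>
  Norming functionals at the points of a countable dense set suffice, since each of them is
  1-Lipschitz. Thus in a separable space the norm is a supremum of countably many functionals.
\<close>

lemma ex_norming_sequence:
  obtains h :: "nat \<Rightarrow> 'a::{real_normed_vector, second_countable_topology} \<Rightarrow>\<^sub>L real"
  where "\<And>y r. (\<forall>k. blinfun_apply (h k) y \<le> r) \<longleftrightarrow> norm y \<le> r"
proof -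
  obtain D :: "'a set" where D: "countable D" "\<And>S. open S \<Longrightarrow> S \<noteq> {} \<Longrightarrow> \<exists>d\<in>D. d \<in> S"
    using countable_dense_setE by metis
  have "D \<noteq> {}" using D(2)[of UNIV] by auto
  obtain F :: "'a \<Rightarrow> 'a \<Rightarrow>\<^sub>L real" where F: "\<And>d. norm (F d) \<le> 1" "\<And>d. blinfun_apply (F d) d = norm d"
    using ex_norming_functional by metis
  define h where "h k = F (from_nat_into D k)" for k
  have F_le: "blinfun_apply (F d) y \<le> norm y" for d y
    using norm_blinfun[of "F d" y] mult_right_mono[OF F(1)[of d], of "norm y"] by simp
  show thesis
  proof (rule that[of h], safe)
    fix y :: 'a and r :: real assume "norm y \<le> r"
    then show "blinfun_apply (h k) y \<le> r" for k
      using F_le[of _ y] by (auto simp: h_def intro: order_trans)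
  next
    fix y :: 'a and r :: real assume le: "\<forall>k. blinfun_apply (h k) y \<le> r"
    show "norm y \<le> r"
    proof (rule field_le_epsilon)
      fix e :: real assume "e > 0"
      then obtain d where d: "d \<in> D" "dist y d < e / 2"
        using D(2)[of "ball y (e/2)"] by auto
      obtain k where "d = from_nat_into D k"
        using from_nat_into_surj[OF D(1) d(1)] by metis
      then have "blinfun_apply (F d) y \<le> r" using le by (auto simp: h_def)
      moreover have "blinfun_apply (F d) (d - y) \<le> norm (d - y)" by (rule F_le)
      ultimately show "norm y \<le> r + e"
        using d(2) F(2)[of d] norm_triangle_ineq2[of y d]
        by (simp add: blinfun.diff_right dist_norm norm_minus_commute)
    qed
  qed
qed

text \<open>
  The generator on which two measures will be compared. Infinitely many half-spaces are allowed so
  that the closed balls of a separable space belong to it; being countable in number, they still let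
  the measure be computed as a limit over finite intersections.
\<close>

definition polyhedral_set :: "'a::real_normed_vector set \<Rightarrow> bool" where
  "polyhedral_set A \<longleftrightarrow>
     (\<exists>(h :: nat \<Rightarrow> 'a \<Rightarrow>\<^sub>L real) c. A = {y. \<forall>k. blinfun_apply (h k) y \<le> c k})"

lemma polyhedral_set_UNIV: "polyhedral_set UNIV"
  unfolding polyhedral_set_def by (intro exI[of _ "\<lambda>_. 0"]) auto

lemma polyhedral_set_cball:
  fixes d :: "'a::{real_normed_vector, second_countable_topology}"
  shows "polyhedral_set (cball d r)"
proof -
  obtain h :: "nat \<Rightarrow> 'a \<Rightarrow>\<^sub>L real"
    where h: "\<And>y r. (\<forall>k. blinfun_apply (h k) y \<le> r) \<longleftrightarrow> norm y \<le> r"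
    using ex_norming_sequence by blast
  have "cball d r = {y. \<forall>k. blinfun_apply (h k) y \<le> blinfun_apply (h k) d + r}"
    using h[of "_ - d" r]
    by (auto simp: dist_norm norm_minus_commute blinfun.diff_right algebra_simps)
  then show ?thesis unfolding polyhedral_set_def by (intro exI)
qed

lemma polyhedral_set_Int:
  assumes "polyhedral_set A" "polyhedral_set B"
  shows "polyhedral_set (A \<inter> B)"
proof -
  obtain h h' :: "nat \<Rightarrow> 'a \<Rightarrow>\<^sub>L real" and c c'
    where A: "A = {y. \<forall>k. blinfun_apply (h k) y \<le> c k}"
      and B: "B = {y. \<forall>k. blinfun_apply (h' k) y \<le> c' k}"
    using assms unfolding polyhedral_set_def by blast
  define H where "H k = (if even k then h (k div 2) else h' (k div 2))" for k :: nat
  define C where "C k = (if even k then c (k div 2) else c' (k div 2))" for k :: nat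
  have "(\<forall>k. blinfun_apply (H k) y \<le> C k) \<longleftrightarrow>
      (\<forall>k. blinfun_apply (h k) y \<le> c k) \<and> (\<forall>k. blinfun_apply (h' k) y \<le> c' k)" for y
  proof safe
    fix k assume *: "\<forall>k. blinfun_apply (H k) y \<le> C k"
    show "blinfun_apply (h k) y \<le> c k" using *[rule_format, of "2 * k"] by (simp add: H_def C_def)
    show "blinfun_apply (h' k) y \<le> c' k" using *[rule_format, of "2 * k + 1"] by (simp add: H_def C_def)
  qed (auto simp: H_def C_def)
  then have "A \<inter> B = {y. \<forall>k. blinfun_apply (H k) y \<le> C k}" by (auto simp: A B)
  then show ?thesis unfolding polyhedral_set_def by blast
qed

lemma closed_polyhedral_set: "polyhedral_set A \<Longrightarrow> closed A"
  unfolding polyhedral_set_def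
  by (auto intro!: closed_Collect_all closed_Collect_le continuous_intros)

lemma sets_borel_eq_sigma_polyhedral:
  "sets (borel :: 'a::{real_normed_vector, second_countable_topology} measure) =
     sigma_sets UNIV {A. polyhedral_set A}"
proof -
  have "sigma_sets UNIV {S :: 'a set. open S} = sigma_sets UNIV {A. polyhedral_set A}"
  proof (rule sigma_sets_eqI)
    fix S :: "'a set" assume "S \<in> {S. open S}"
    then have S: "open S" by simp
    obtain D :: "'a set" where D: "countable D" "\<And>S. open S \<Longrightarrow> S \<noteq> {} \<Longrightarrow> \<exists>d\<in>D. d \<in> S"
      using countable_dense_setE by metis
    define I where "I = {(d, r). d \<in> D \<and> r \<in> \<rat> \<and> cball d r \<subseteq> S}"
    have "countable I"
      by (rule countable_subset[of _ "D \<times> \<rat>"]) (auto simp: I_def D countable_rat)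
    have "S = (\<Union>(d, r)\<in>I. cball d r)"
    proof (intro equalityI subsetI)
      fix y assume "y \<in> S"
      then obtain e where e: "e > 0" "ball y e \<subseteq> S" using S open_contains_ball by blast
      obtain d where d: "d \<in> D" "dist y d < e / 2" using D(2)[of "ball y (e/2)"] e by auto
      obtain r where r: "r \<in> \<rat>" "dist y d < r" "r < e / 2" using Rats_dense_in_real[OF d(2)] by blast
      have "cball d r \<subseteq> ball y e"
      proof
        fix z assume "z \<in> cball d r"
        then show "z \<in> ball y e" using dist_triangle[of y z d] d(2) r(3) by simp
      qed
      then have "(d, r) \<in> I" using d r e unfolding I_def by blast
      moreover have "y \<in> cball d r" using r by (simp add: dist_commute)
      ultimately show "y \<in> (\<Union>(d, r)\<in>I. cball d r)" by blast
    qed (auto simp: I_def)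
    moreover have "(\<Union>(d, r)\<in>I. cball d r) \<in> sigma_sets UNIV {A. polyhedral_set A}"
      using \<open>countable I\<close>
      by (intro sigma_sets_UNION) (auto intro!: sigma_sets.Basic polyhedral_set_cball)
    ultimately show "S \<in> sigma_sets UNIV {A. polyhedral_set A}" by simp
  next
    fix A :: "'a set" assume "A \<in> {A. polyhedral_set A}"
    then have "- A \<in> {S. open S}" using closed_polyhedral_set by auto
    then have "UNIV - (- A) \<in> sigma_sets UNIV {S. open S}"
      by (intro sigma_sets.Compl sigma_sets.Basic)
    then show "A \<in> sigma_sets UNIV {S. open S}" by (simp add: Compl_eq_Diff_UNIV[symmetric])
  qed
  then show ?thesis by (simp add: borel_def)
qed

text \<open>
  Levy's uniqueness theorem for the distribution of \<open>X\<close> under the finite measure with density \<open>u\<close>.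
  It is stated with integrals instead of measures because the weights are built up factor by
  factor below.
\<close>

lemma Levy_uniqueness_weighted:
  fixes M N :: "'b measure" and X u :: "'b \<Rightarrow> real"
  assumes "finite_measure M" "finite_measure N"
    and [measurable]: "X \<in> borel_measurable M" "X \<in> borel_measurable N"
      "u \<in> borel_measurable M" "u \<in> borel_measurable N" "B \<in> sets borel"
    and u: "\<And>y. 0 \<le> u y" "\<And>y. u y \<le> C"
    and eq: "\<And>t. (CLINT y|M. u y *\<^sub>R iexp (t * X y)) = (CLINT y|N. u y *\<^sub>R iexp (t * X y))"
  shows "(\<integral>y. u y * indicator B (X y) \<partial>M) = (\<integral>y. u y * indicator B (X y) \<partial>N)"
proof -
  interpret M: finite_measure M by fact
  interpret N: finite_measure N by fact
  have int [simp]: "integrable M u" "integrable N u"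
    using u by (auto intro!: M.integrable_const_bound[of _ C] N.integrable_const_bound[of _ C])
  have intB [simp]: "integrable M (\<lambda>y. u y * indicator B (X y))" "integrable N (\<lambda>y. u y * indicator B (X y))"
    by (auto intro!: Bochner_Integration.integrable_bound[OF int(1)]
        Bochner_Integration.integrable_bound[OF int(2)] simp: indicator_def)
  define m where "m = (\<integral>y. u y \<partial>M)"
  have m: "m = (\<integral>y. u y \<partial>N)"
    using eq[of 0] by (simp add: m_def scaleR_conv_of_real)
  show ?thesis
  proof (cases "m = 0")
    case True
    have le: "u y * indicator B (X y) \<le> u y" "0 \<le> u y * indicator B (X y)" for y
      using u[of y] by (auto simp: indicator_def)
    have "(\<integral>y. u y * indicator B (X y) \<partial>M) = 0"
    proof (rule antisym)
      show "(\<integral>y. u y * indicator B (X y) \<partial>M) \<le> 0"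
        using integral_mono[OF intB(1) int(1) le(1)] True m_def by simp
    qed (rule Bochner_Integration.integral_nonneg[OF le(2)])
    moreover have "(\<integral>y. u y * indicator B (X y) \<partial>N) = 0"
    proof (rule antisym)
      show "(\<integral>y. u y * indicator B (X y) \<partial>N) \<le> 0"
        using integral_mono[OF intB(2) int(2) le(1)] True m by simp
    qed (rule Bochner_Integration.integral_nonneg[OF le(2)])
    ultimately show ?thesis by simp
  next
    case False
    have "m \<ge> 0" using u by (simp add: m_def)
    with False have "m > 0" by simp
    define L where "L Q = distr (density Q (\<lambda>y. u y / m)) borel X" for Q
    have main: "real_distribution (L Q)" "char (L Q) t = (CLINT y|Q. u y *\<^sub>R iexp (t * X y)) / m"
      "m * measure (L Q) B = (\<integral>y. u y * indicator B (X y) \<partial>Q)"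
      if [measurable]: "X \<in> borel_measurable Q" "u \<in> borel_measurable Q"
        and int: "integrable Q u" and m: "m = (\<integral>y. u y \<partial>Q)" for Q t
    proof -
      have "prob_space (density Q (\<lambda>y. ennreal (u y / m)))"
      proof (rule prob_spaceI)
        have "emeasure (density Q (\<lambda>y. ennreal (u y / m))) (space (density Q (\<lambda>y. ennreal (u y / m)))) =
            (\<integral>\<^sup>+y. ennreal (u y / m) \<partial>Q)"
          by (auto simp: emeasure_density intro!: nn_integral_cong)
        also have "\<dots> = ennreal (\<integral>y. u y / m \<partial>Q)"
          using u \<open>m > 0\<close> int by (intro nn_integral_eq_integral) auto
        also have "\<dots> = 1" using \<open>m > 0\<close> m by simp
        finally show "emeasure (density Q (\<lambda>y. ennreal (u y / m)))
            (space (density Q (\<lambda>y. ennreal (u y / m)))) = 1" .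
      qed
      then interpret D: prob_space "density Q (\<lambda>y. ennreal (u y / m))" .
      show "real_distribution (L Q)"
        unfolding L_def real_distribution_def real_distribution_axioms_def
        by (auto intro!: D.prob_space_distr)
      have "char (L Q) t = (CLINT y|Q. (u y / m) *\<^sub>R iexp (t * X y))"
        using u \<open>m > 0\<close> by (simp add: char_def L_def integral_distr integral_density)
      also have "\<dots> = (CLINT y|Q. (u y *\<^sub>R iexp (t * X y)) / m)"
        by (simp add: scaleR_conv_of_real)
      finally show "char (L Q) t = (CLINT y|Q. u y *\<^sub>R iexp (t * X y)) / m" by simp
      have "measure (L Q) B = (\<integral>y. indicator B y \<partial>L Q)" by (simp add: L_def)
      also have "\<dots> = (\<integral>y. indicator B (X y) \<partial>density Q (\<lambda>y. ennreal (u y / m)))"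
        unfolding L_def by (rule integral_distr) auto
      also have "\<dots> = (\<integral>y. (u y / m) *\<^sub>R indicator B (X y) \<partial>Q)"
        using u \<open>m > 0\<close> by (intro integral_density) auto
      also have "\<dots> = (\<integral>y. (u y * indicator B (X y)) / m \<partial>Q)" by simp
      finally show "m * measure (L Q) B = (\<integral>y. u y * indicator B (X y) \<partial>Q)"
        using \<open>m > 0\<close> by simp
    qed
    \<comment> \<open>After division by the common total mass \<open>m\<close> both distributions are probability measures.\<close>
    have "L M = L N"
      using main(1,2)[of M] main(1,2)[of N] m m_def eq
      by (intro Levy_uniqueness) (auto simp: fun_eq_iff)
    then show ?thesis using main(3)[of M] main(3)[of N] m m_def by simp
  qed
qed

lemma integrable_weighted_iexp:
  assumes "finite_measure M" and [measurable]: "w \<in> borel_measurable M" "g \<in> borel_measurable M"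
    and w: "\<And>y. 0 \<le> w y" "\<And>y. w y \<le> 1"
  shows "integrable M (\<lambda>y. w y *\<^sub>R iexp (g y))"
proof -
  interpret finite_measure M by fact
  show ?thesis
    by (rule integrable_const_bound[of _ 1]) (use w in auto)
qed

lemma blinfun_apply_borel_measurable [measurable]:
  "blinfun_apply (h :: 'a::real_normed_vector \<Rightarrow>\<^sub>L real) \<in> borel_measurable borel"
  by (intro borel_measurable_continuous_onI continuous_intros)

text \<open>
  The step that reduces several functionals to one. If \<open>w\<close> times every character \<open>iexp g\<close> has the
  same integral under \<open>M\<close> and \<open>N\<close>, then for fixed \<open>g\<close> the nonnegative weight
  \<open>w * (1 + Re (a * iexp g))\<close> with \<open>norm a \<le> 1\<close> gives \<open>f\<close> the same Fourier transform under \<open>M\<close>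
  and \<open>N\<close>, because a product of characters is a character. One-dimensional uniqueness then allows
  the factor \<open>indicator B (f y)\<close> to be inserted, and \<open>a = 1\<close>, \<open>a = - \<i>\<close> recover real and imaginary
  part.
\<close>

lemma weighted_char_functional_eq_restrict:
  fixes M N :: "'a::{real_normed_vector, second_countable_topology} measure"
    and f :: "'a \<Rightarrow>\<^sub>L real"
  assumes "finite_measure M" "finite_measure N"
    and [measurable_cong]: "sets M = sets borel" "sets N = sets borel"
    and [measurable]: "w \<in> borel_measurable borel" "B \<in> sets borel"
    and w: "\<And>y. 0 \<le> w y" "\<And>y. w y \<le> 1"
    and eq: "\<And>g :: 'a \<Rightarrow>\<^sub>L real.
      (CLINT y|M. w y *\<^sub>R iexp (g y)) = (CLINT y|N. w y *\<^sub>R iexp (g y))"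
  shows "(CLINT y|M. (indicator B (blinfun_apply f y) * w y) *\<^sub>R iexp (blinfun_apply g y)) =
         (CLINT y|N. (indicator B (blinfun_apply f y) * w y) *\<^sub>R iexp (blinfun_apply g y))"
proof -
  define W where "W y = indicator B (blinfun_apply f y) * w y" for y
  have [measurable]: "W \<in> borel_measurable borel" by (simp add: W_def[abs_def])
  have W: "0 \<le> W y" "W y \<le> 1" for y using w[of y] by (auto simp: W_def indicator_def)
  have fin: "finite_measure Q" "sets Q = sets borel" if "Q \<in> {M, N}" for Q
    using that assms by auto
  have int: "integrable Q (\<lambda>y. v y *\<^sub>R iexp (blinfun_apply h y))"
    if Q: "Q \<in> {M, N}" and v: "v = w \<or> v = W" for Q v and h :: "'a \<Rightarrow>\<^sub>L real"
  proof -
    note [measurable_cong] = fin(2)[OF Q]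
    show ?thesis using v by (intro integrable_weighted_iexp fin(1)[OF Q]) (auto simp: w W)
  qed
  have int_real: "integrable Q v" if "Q \<in> {M, N}" "v = w \<or> v = W" for Q v
    using int[OF that, of 0] integrable_Re[of Q "\<lambda>y. of_real (v y)"]
    by (simp add: scaleR_conv_of_real)
  have Re_eq: "Re (a * (CLINT y|M. W y *\<^sub>R iexp (blinfun_apply g y))) =
      Re (a * (CLINT y|N. W y *\<^sub>R iexp (blinfun_apply g y)))" if a: "norm a \<le> 1" for a
  proof -
    define u where "u y = w y * (1 + Re (a * iexp (blinfun_apply g y)))" for y
    have [measurable]: "u \<in> borel_measurable borel" by (simp add: u_def[abs_def])
    have bound: "\<bar>Re (a * iexp (blinfun_apply g y))\<bar> \<le> 1" for y
      using abs_Re_le_cmod[of "a * iexp (blinfun_apply g y)"] a by (simp add: norm_mult)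
    have u: "0 \<le> u y" "u y \<le> 2" for y
    proof -
      show "0 \<le> u y" using w[of y] bound[of y] unfolding u_def by (intro mult_nonneg_nonneg) auto
      have "u y \<le> 1 * 2" using w[of y] bound[of y] unfolding u_def by (intro mult_mono) auto
      then show "u y \<le> 2" by simp
    qed
    have point: "u y *\<^sub>R iexp (t * blinfun_apply f y) = w y *\<^sub>R iexp (blinfun_apply (t *\<^sub>R f) y) +
        (a / 2) * (w y *\<^sub>R iexp (blinfun_apply (t *\<^sub>R f + g) y)) +
        (cnj a / 2) * (w y *\<^sub>R iexp (blinfun_apply (t *\<^sub>R f - g) y))" for y t
    proof -
      have Re: "complex_of_real (Re z) = z / 2 + cnj z / 2" for z
        by (simp add: complex_eq_iff)
      have "cnj (iexp (blinfun_apply g y)) = iexp (- blinfun_apply g y)"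
        by (simp add: exp_cnj)
      then show ?thesis
        unfolding u_def scaleR_conv_of_real of_real_mult of_real_add Re
        by (simp add: blinfun.add_left blinfun.diff_left blinfun.scaleR_left exp_add exp_diff
            exp_minus field_simps)
    qed
    have "(CLINT y|Q. u y *\<^sub>R iexp (t * blinfun_apply f y)) =
        (CLINT y|Q. w y *\<^sub>R iexp (blinfun_apply (t *\<^sub>R f) y)) +
        (a / 2) * (CLINT y|Q. w y *\<^sub>R iexp (blinfun_apply (t *\<^sub>R f + g) y)) +
        (cnj a / 2) * (CLINT y|Q. w y *\<^sub>R iexp (blinfun_apply (t *\<^sub>R f - g) y))"
      if "Q \<in> {M, N}" for t Q
      unfolding point using int[OF that, of w] by (simp del: mult_scaleR_right times_divide_eq_left)
    then have "(\<integral>y. u y * indicator B (blinfun_apply f y) \<partial>M) = (\<integral>y. u y * indicator B (blinfun_apply f y) \<partial>N)"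
      by (intro Levy_uniqueness_weighted[where C = 2] assms u) (auto simp: eq)
    moreover have "(\<integral>y. u y * indicator B (blinfun_apply f y) \<partial>Q) =
        (\<integral>y. W y \<partial>Q) + Re (a * (CLINT y|Q. W y *\<^sub>R iexp (blinfun_apply g y)))"
      if Q: "Q \<in> {M, N}" for Q
    proof -
      have "(\<integral>y. u y * indicator B (blinfun_apply f y) \<partial>Q) =
          (\<integral>y. W y + Re (a * (W y *\<^sub>R iexp (blinfun_apply g y))) \<partial>Q)"
        by (intro Bochner_Integration.integral_cong) (auto simp: u_def W_def algebra_simps)
      also have "\<dots> = (\<integral>y. W y \<partial>Q) + (\<integral>y. Re (a * (W y *\<^sub>R iexp (blinfun_apply g y))) \<partial>Q)"
        using int[OF Q, of W] int_real[OF Q, of W] by (intro Bochner_Integration.integral_add integrable_Re integrable_mult_right) auto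
      also have "(\<integral>y. Re (a * (W y *\<^sub>R iexp (blinfun_apply g y))) \<partial>Q) =
          Re (CLINT y|Q. a * (W y *\<^sub>R iexp (blinfun_apply g y)))"
        using int[OF Q, of W] by (intro integral_Re integrable_mult_right) auto
      also have "\<dots> = Re (a * (CLINT y|Q. W y *\<^sub>R iexp (blinfun_apply g y)))"
        by (simp only: integral_mult_right_zero)
      finally show ?thesis .
    qed
    moreover have "(\<integral>y. W y \<partial>M) = (\<integral>y. W y \<partial>N)"
      using Levy_uniqueness_weighted[of M N "blinfun_apply f" w B 1] eq[of "_ *\<^sub>R f"] assms
      by (simp add: W_def[abs_def] mult.commute blinfun.scaleR_left)
    ultimately show ?thesis by simp
  qed
  have "(CLINT y|M. W y *\<^sub>R iexp (blinfun_apply g y)) = (CLINT y|N. W y *\<^sub>R iexp (blinfun_apply g y))"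
    using Re_eq[of 1] Re_eq[of "- \<i>"] by (simp add: complex_eq_iff)
  then show ?thesis by (simp add: W_def)
qed

definition char_functional :: "'a::real_normed_vector measure \<Rightarrow> ('a \<Rightarrow>\<^sub>L real) \<Rightarrow> complex" where
  "char_functional M g = (CLINT y|M. iexp (blinfun_apply g y))"

text \<open>
  Starting from the constant weight 1, half-spaces are inserted one at a time; the functional
  0 then shows that the two measures agree on finite, hence on countable, intersections of
  half-spaces, and these form an intersection-stable generator of the Borel sets.
\<close>

theorem char_functional_unique:
  fixes M N :: "'a::{real_normed_vector, second_countable_topology} measure"
  assumes M: "finite_measure M" and N: "finite_measure N"
    and sets [measurable_cong]: "sets M = sets borel" "sets N = sets borel"
    and eq: "char_functional M = char_functional N"
  shows "M = N"
proof (rule measure_eqI_generator_eq[where E = "{A. polyhedral_set A}" and \<Omega> = UNIV and A = "\<lambda>_. UNIV"])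
  interpret M: finite_measure M by fact
  interpret N: finite_measure N by fact
  fix A :: "'a set" assume "A \<in> {A. polyhedral_set A}"
  then obtain h :: "nat \<Rightarrow> 'a \<Rightarrow>\<^sub>L real" and c where A: "A = {y. \<forall>k. blinfun_apply (h k) y \<le> c k}"
    by (auto simp: polyhedral_set_def)
  define S where "S n = {y. \<forall>k<n. blinfun_apply (h k) y \<le> c k}" for n
  have closed: "closed (S n)" for n
    unfolding S_def by (auto intro!: closed_Collect_all closed_Collect_imp closed_Collect_le continuous_intros)
  have [measurable]: "S n \<in> sets borel" for n using closed by (rule borel_closed)
  have "\<forall>g. (CLINT y|M. (indicator (S n) y :: real) *\<^sub>R iexp (blinfun_apply g y)) =
      (CLINT y|N. (indicator (S n) y :: real) *\<^sub>R iexp (blinfun_apply g y))" for n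
  proof (induction n)
    case 0
    then show ?case using eq by (simp add: S_def char_functional_def fun_eq_iff)
  next
    case (Suc n)
    have "indicator (S (Suc n)) y = (indicator {..c n} (blinfun_apply (h n) y) * indicator (S n) y :: real)" for y
      by (auto simp: S_def indicator_def less_Suc_eq)
    then show ?case
      using weighted_char_functional_eq_restrict[OF M N sets, of "indicator (S n)" "{..c n}" "h n"] Suc
      by simp
  qed
  from this[THEN spec, of _ 0] have S: "measure M (S n) = measure N (S n)" for n
    by (simp add: scaleR_conv_of_real sets_eq_imp_space_eq[OF sets(1)] sets_eq_imp_space_eq[OF sets(2)])
  have "decseq S" by (auto simp: S_def decseq_def)
  then have "(\<lambda>n. measure M (S n)) \<longlonglongrightarrow> measure M (\<Inter>n. S n)"
    "(\<lambda>n. measure N (S n)) \<longlonglongrightarrow> measure N (\<Inter>n. S n)"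
    by (auto intro!: M.finite_Lim_measure_decseq N.finite_Lim_measure_decseq simp: sets)
  then have "measure M (\<Inter>n. S n) = measure N (\<Inter>n. S n)" unfolding S by (rule LIMSEQ_unique)
  moreover have "A = (\<Inter>n. S n)" by (auto simp: A S_def)
  ultimately show "emeasure M A = emeasure N A" by (simp add: M.emeasure_eq_measure N.emeasure_eq_measure)
next
  show "emeasure M UNIV \<noteq> \<infinity>" using finite_measure.emeasure_finite[OF M] by simp
qed (auto simp: Int_stable_def polyhedral_set_Int polyhedral_set_UNIV sets sets_borel_eq_sigma_polyhedral)

section \<open>Second moments of Gaussian measures\<close>

lemma centered_gaussian_real_char:
  assumes "centered_gaussian_real \<nu>"
  shows "integrable \<nu> (\<lambda>x. x\<^sup>2)" "char \<nu> 1 = complex_of_real (exp (- (\<integral>x. x\<^sup>2 \<partial>\<nu>) / 2))"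
proof -
  have "integrable \<nu> (\<lambda>x. x\<^sup>2) \<and> char \<nu> 1 = complex_of_real (exp (- (\<integral>x. x\<^sup>2 \<partial>\<nu>) / 2))"
    using assms unfolding centered_gaussian_real_def
  proof (elim disjE exE conjE)
    assume \<nu>: "\<nu> = return borel 0"
    have "integrable (return borel 0) (\<lambda>x::real. x\<^sup>2)"
      by (rule integrableI_bounded) (auto simp: nn_integral_return)
    then show ?thesis by (simp add: \<nu> char_def integral_return)
  next
    fix \<sigma> :: real assume \<sigma>: "\<sigma> > 0" and \<nu>: "\<nu> = density lborel (normal_density 0 \<sigma>)"
    have int: "integrable \<nu> (\<lambda>x. x\<^sup>2)"
      unfolding \<nu> using integrable_normal_moment[OF \<sigma>, of 0 2]
      by (subst integrable_density) (auto simp: normal_density_nonneg)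
    have var: "(\<integral>x. x\<^sup>2 \<partial>\<nu>) = \<sigma>\<^sup>2"
      unfolding \<nu> using integral_normal_moment_even[OF \<sigma>, of 0 1]
      by (subst integral_density) (auto simp: normal_density_nonneg fact_numeral)
    interpret S: prob_space std_normal_distribution
      by (rule prob_space_normal_density) simp
    \<comment> \<open>Only the standard normal distribution has to be transformed: \<open>\<nu>\<close> is its image under scaling by \<open>\<sigma>\<close>.\<close>
    have "distributed std_normal_distribution lborel (\<lambda>x. 0 + \<sigma> * x)
        (normal_density (0 + \<sigma> * 0) (\<bar>\<sigma>\<bar> * 1))"
      using \<sigma> by (intro S.normal_density_affine) (auto simp: distributed_def distr_id2)
    then have "\<nu> = distr std_normal_distribution lborel (\<lambda>x. \<sigma> * x)"
      using \<sigma> by (simp add: distributed_def \<nu>)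
    then have "char \<nu> 1 = char std_normal_distribution \<sigma>"
      by (simp add: char_def integral_distr)
    then show ?thesis using int var by (simp add: char_std_normal_distribution)
  qed
  then show "integrable \<nu> (\<lambda>x. x\<^sup>2)" "char \<nu> 1 = complex_of_real (exp (- (\<integral>x. x\<^sup>2 \<partial>\<nu>) / 2))" by auto
qed

lemma centered_gaussian_char_functional:
  fixes g :: "'a::real_normed_vector \<Rightarrow>\<^sub>L real"
  assumes "centered_gaussian \<gamma>"
  shows "integrable \<gamma> (\<lambda>y. (blinfun_apply g y)\<^sup>2)"
    "char_functional \<gamma> g = complex_of_real (exp (- (\<integral>y. (blinfun_apply g y)\<^sup>2 \<partial>\<gamma>) / 2))"
proof -
  have [measurable_cong]: "sets \<gamma> = sets borel"
    and "centered_gaussian_real (distr \<gamma> borel (blinfun_apply g))"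
    using assms by (auto simp: centered_gaussian_def)
  note * = centered_gaussian_real_char[OF this(2)]
  show "integrable \<gamma> (\<lambda>y. (blinfun_apply g y)\<^sup>2)"
    using *(1) by (subst (asm) integrable_distr_eq) auto
  show "char_functional \<gamma> g = complex_of_real (exp (- (\<integral>y. (blinfun_apply g y)\<^sup>2 \<partial>\<gamma>) / 2))"
    using *(2) by (simp add: char_functional_def char_def integral_distr)
qed

lemma char_functional_pair:
  fixes M :: "'a::{real_normed_vector, second_countable_topology} measure"
    and N :: "'b::{real_normed_vector, second_countable_topology} measure"
  assumes "prob_space M" "prob_space N"
    and [measurable_cong]: "sets M = sets borel" "sets N = sets borel"
    and h: "\<And>x y. blinfun_apply h (x, y) = blinfun_apply f x + blinfun_apply g y"
  shows "char_functional (M \<Otimes>\<^sub>M N) h = char_functional M f * char_functional N g"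
proof -
  interpret M: prob_space M by fact
  interpret N: prob_space N by fact
  interpret pair_prob_space M N ..
  have eq: "iexp (blinfun_apply h (x, y)) = iexp (blinfun_apply f x) * iexp (blinfun_apply g y)" for x y
    by (simp add: h exp_add distrib_left)
  have "(\<lambda>z. iexp (blinfun_apply h z)) = (\<lambda>z. iexp (blinfun_apply f (fst z)) * iexp (blinfun_apply g (snd z)))"
    using eq by auto
  then have "integrable (M \<Otimes>\<^sub>M N) (\<lambda>z. iexp (blinfun_apply h z))"
    by (auto intro!: P.integrable_const_bound[of _ 1] simp: norm_mult)
  from integral_fst'[OF this] show ?thesis
    by (simp add: char_functional_def eq)
qed

text \<open>
  The rotation by 45 degrees that mixes two independent copies.
\<close>

definition rotate_pair :: "'a \<times> 'a \<Rightarrow> 'a \<times> 'a::real_normed_vector" where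
  "rotate_pair z = ((1 / sqrt 2) *\<^sub>R (fst z - snd z), (1 / sqrt 2) *\<^sub>R (fst z + snd z))"

lemma bounded_linear_rotate_pair: "bounded_linear rotate_pair"
  unfolding rotate_pair_def[abs_def] by (intro bounded_linear_intros)

text \<open>
  The characteristic functional of the product measure at \<open>(f, g)\<close> is \<open>exp (- (q f + q g) / 2)\<close> with
  \<open>q f\<close> the variance of \<open>f\<close>. Rotating replaces \<open>(f, g)\<close> by \<open>((f + g) / sqrt 2, (g - f) / sqrt 2)\<close>,
  which does not change \<open>q f + q g\<close> by the parallelogram law.
\<close>

lemma gaussian_pair_rotation_invariant:
  fixes \<gamma> :: "'a::{real_normed_vector, second_countable_topology} measure"
  assumes "centered_gaussian \<gamma>"
  shows "distr (\<gamma> \<Otimes>\<^sub>M \<gamma>) borel rotate_pair = \<gamma> \<Otimes>\<^sub>M \<gamma>"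
proof -
  have sets [measurable_cong]: "sets \<gamma> = sets borel" and prob: "prob_space \<gamma>"
    using assms by (auto simp: centered_gaussian_def)
  interpret prob_space \<gamma> by fact
  interpret P: pair_prob_space \<gamma> \<gamma> ..
  have sets2 [measurable_cong]: "sets (\<gamma> \<Otimes>\<^sub>M \<gamma>) = sets borel"
    using sets_pair_measure_cong[OF sets sets] unfolding borel_prod .
  have [measurable]: "rotate_pair \<in> borel \<rightarrow>\<^sub>M (borel :: ('a \<times> 'a) measure)"
    by (intro borel_measurable_continuous_onI linear_continuous_on bounded_linear_rotate_pair)
  define q where "q g = (\<integral>y. (blinfun_apply g y)\<^sup>2 \<partial>\<gamma>)" for g :: "'a \<Rightarrow>\<^sub>L real"
  have pair: "char_functional (\<gamma> \<Otimes>\<^sub>M \<gamma>) h = complex_of_real (exp (- (q f + q g) / 2))"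
    if "\<And>x y. blinfun_apply h (x, y) = blinfun_apply f x + blinfun_apply g y" for h f g
  proof -
    have "exp (- (q f + q g) / 2) = exp (- q f / 2) * exp (- q g / 2)"
      unfolding exp_add[symmetric] by (simp add: field_simps)
    then show ?thesis
      using char_functional_pair[OF prob prob sets sets that]
      by (simp add: centered_gaussian_char_functional[OF assms] q_def)
  qed
  have parallelogram: "q ((1 / sqrt 2) *\<^sub>R (f + g)) + q ((1 / sqrt 2) *\<^sub>R (g - f)) = q f + q g" for f g
  proof -
    have "q ((1 / sqrt 2) *\<^sub>R (f + g)) + q ((1 / sqrt 2) *\<^sub>R (g - f)) =
        (\<integral>y. (blinfun_apply ((1 / sqrt 2) *\<^sub>R (f + g)) y)\<^sup>2 + (blinfun_apply ((1 / sqrt 2) *\<^sub>R (g - f)) y)\<^sup>2 \<partial>\<gamma>)"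
      unfolding q_def by (intro Bochner_Integration.integral_add[symmetric] centered_gaussian_char_functional[OF assms])
    also have "\<dots> = (\<integral>y. (blinfun_apply f y)\<^sup>2 + (blinfun_apply g y)\<^sup>2 \<partial>\<gamma>)"
      by (intro Bochner_Integration.integral_cong)
        (auto simp: blinfun.scaleR_left blinfun.add_left blinfun.diff_left power_divide power2_eq_square field_simps)
    also have "\<dots> = q f + q g"
      unfolding q_def by (intro Bochner_Integration.integral_add centered_gaussian_char_functional[OF assms])
    finally show ?thesis .
  qed
  show ?thesis
  proof (rule char_functional_unique)
    show "finite_measure (distr (\<gamma> \<Otimes>\<^sub>M \<gamma>) borel rotate_pair)"
      by (intro P.P.finite_measure_distr) simp
    show "char_functional (distr (\<gamma> \<Otimes>\<^sub>M \<gamma>) borel rotate_pair) = char_functional (\<gamma> \<Otimes>\<^sub>M \<gamma>)"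
    proof
      fix h :: "('a \<times> 'a) \<Rightarrow>\<^sub>L real"
      define f where "f = h o\<^sub>L Blinfun (\<lambda>x. (x, 0))"
      define g where "g = h o\<^sub>L Blinfun (\<lambda>y. (0, y))"
      have f: "blinfun_apply f x = blinfun_apply h (x, 0)" for x
        unfolding f_def by (simp add: bounded_linear_Blinfun_apply bounded_linear_Pair bounded_linear_ident bounded_linear_zero)
      have g: "blinfun_apply g x = blinfun_apply h (0, x)" for x
        unfolding g_def by (simp add: bounded_linear_Blinfun_apply bounded_linear_Pair bounded_linear_ident bounded_linear_zero)
      have h: "blinfun_apply h (x, y) = blinfun_apply f x + blinfun_apply g y" for x y
        using blinfun.add_right[of h "(x, 0)" "(0, y)"] by (simp add: f g)
      define h' where "h' = h o\<^sub>L Blinfun rotate_pair"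
      have h': "blinfun_apply h' z = blinfun_apply h (rotate_pair z)" for z
        unfolding h'_def by (simp add: bounded_linear_Blinfun_apply bounded_linear_rotate_pair)
      have "char_functional (distr (\<gamma> \<Otimes>\<^sub>M \<gamma>) borel rotate_pair) h = char_functional (\<gamma> \<Otimes>\<^sub>M \<gamma>) h'"
        by (simp add: char_functional_def integral_distr h')
      also have "\<dots> = complex_of_real (exp (- (q ((1 / sqrt 2) *\<^sub>R (f + g)) + q ((1 / sqrt 2) *\<^sub>R (g - f))) / 2))"
        by (rule pair)
          (simp add: h' rotate_pair_def h blinfun.scaleR_left blinfun.scaleR_right blinfun.add_left
            blinfun.diff_left blinfun.add_right blinfun.diff_right algebra_simps add_divide_distrib diff_divide_distrib)
      also have "\<dots> = char_functional (\<gamma> \<Otimes>\<^sub>M \<gamma>) h"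
        unfolding parallelogram by (rule pair[OF h, symmetric])
      finally show "char_functional (distr (\<gamma> \<Otimes>\<^sub>M \<gamma>) borel rotate_pair) h = char_functional (\<gamma> \<Otimes>\<^sub>M \<gamma>) h" .
    qed
  qed (simp_all add: sets2 P.P.finite_measure_axioms)
qed

text \<open>
  Fernique's inequality. For independent copies \<open>X\<close>, \<open>Y\<close> the left side is the probability that
  \<open>norm (X - Y) \<le> sqrt 2 * s\<close> and \<open>norm (X + Y) > sqrt 2 * t\<close>, by rotation invariance. On that event
  both \<open>2 * norm X\<close> and \<open>2 * norm Y\<close> exceed \<open>sqrt 2 * (t - s)\<close>.
\<close>

lemma gaussian_tail_doubling:
  fixes \<gamma> :: "'a::{real_normed_vector, second_countable_topology} measure"
  assumes "centered_gaussian \<gamma>"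
  shows "measure \<gamma> {y. norm y \<le> s} * measure \<gamma> {y. norm y > t} \<le>
    (measure \<gamma> {y. norm y > (t - s) / sqrt 2})\<^sup>2"
proof -
  have sets [measurable_cong]: "sets \<gamma> = sets borel" and prob: "prob_space \<gamma>"
    using assms by (auto simp: centered_gaussian_def)
  interpret prob_space \<gamma> by fact
  interpret P: pair_prob_space \<gamma> \<gamma> ..
  have space: "space \<gamma> = UNIV" using sets_eq_imp_space_eq[OF sets] by simp
  have sets2 [measurable_cong]: "sets (\<gamma> \<Otimes>\<^sub>M \<gamma>) = sets borel"
    using sets_pair_measure_cong[OF sets sets] unfolding borel_prod .
  have rot [measurable]: "rotate_pair \<in> borel \<rightarrow>\<^sub>M (borel :: ('a \<times> 'a) measure)"
    by (intro borel_measurable_continuous_onI linear_continuous_on bounded_linear_rotate_pair)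
  have times: "measure (\<gamma> \<Otimes>\<^sub>M \<gamma>) (A \<times> B) = measure \<gamma> A * measure \<gamma> B"
    if "A \<in> sets \<gamma>" "B \<in> sets \<gamma>" for A B
    using that by (simp add: measure_def emeasure_pair_measure_Times enn2real_mult)
  let ?A = "{y :: 'a. norm y \<le> s}" and ?B = "{y :: 'a. norm y > t}"
    and ?C = "{y :: 'a. norm y > (t - s) / sqrt 2}"
  have [measurable]: "?A \<in> sets borel" "?B \<in> sets borel" "?C \<in> sets borel" by measurable
  have "measure \<gamma> ?A * measure \<gamma> ?B = measure (\<gamma> \<Otimes>\<^sub>M \<gamma>) (?A \<times> ?B)"
    by (simp add: times sets)
  also have "\<dots> = measure (distr (\<gamma> \<Otimes>\<^sub>M \<gamma>) borel rotate_pair) (?A \<times> ?B)"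
    by (simp add: gaussian_pair_rotation_invariant[OF assms])
  also have "\<dots> = measure (\<gamma> \<Otimes>\<^sub>M \<gamma>) (rotate_pair -` (?A \<times> ?B))"
    by (subst measure_distr) (auto simp: space_pair_measure space borel_Times)
  also have "\<dots> \<le> measure (\<gamma> \<Otimes>\<^sub>M \<gamma>) (?C \<times> ?C)"
  proof (rule P.P.finite_measure_mono)
    show "rotate_pair -` (?A \<times> ?B) \<subseteq> ?C \<times> ?C"
    proof
      fix z assume "z \<in> rotate_pair -` (?A \<times> ?B)"
      moreover obtain x y where z: "z = (x, y)" by (cases z)
      ultimately have le: "norm (x - y) \<le> sqrt 2 * s" and gt: "norm (x + y) > sqrt 2 * t"
        by (auto simp: rotate_pair_def pos_divide_le_eq pos_less_divide_eq mult.commute)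
      have "norm (x + y) - norm (x - y) \<le> norm (2 *\<^sub>R x)" "norm (x + y) - norm (x - y) \<le> norm (2 *\<^sub>R y)"
        using norm_triangle_ineq2[of "x + y" "y - x"] norm_triangle_ineq2[of "x + y" "x - y"]
        by (simp_all add: scaleR_2 norm_minus_commute)
      with le gt have "sqrt 2 * (t - s) < 2 * norm x" "sqrt 2 * (t - s) < 2 * norm y"
        by (simp_all add: right_diff_distrib)
      moreover have eq: "(t - s) / sqrt 2 = sqrt 2 * (t - s) / 2" by (simp add: field_simps)
      ultimately show "z \<in> ?C \<times> ?C" unfolding eq z by simp
    qed
    show "?C \<times> ?C \<in> sets (\<gamma> \<Otimes>\<^sub>M \<gamma>)" by (intro pair_measureI) (auto simp: sets)
  qed
  also have "\<dots> = (measure \<gamma> ?C)\<^sup>2" by (simp add: times sets power2_eq_square)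
  finally show ?thesis .
qed

text \<open>
  On the shell where \<open>norm y\<close> lies between \<open>2 ^ n * a\<close> and \<open>2 ^ Suc n * a\<close> the squared norm is of order
  \<open>4 ^ n\<close>, which a tail decaying like \<open>(1 / 8) ^ n\<close> compensates.
\<close>

lemma integrable_norm_squared_of_dyadic_tails:
  fixes M :: "'a::real_normed_vector measure"
  assumes "finite_measure M" and [measurable_cong]: "sets M = sets borel"
    and a: "a > 0" and tail: "\<And>n. measure M {y. norm y > 2 ^ n * a} \<le> (1 / 8) ^ n"
  shows "integrable M (\<lambda>y. (norm y)\<^sup>2)"
proof (rule integrableI_bounded)
  interpret finite_measure M by fact
  have [measurable]: "{y :: 'a. norm y > c} \<in> sets borel" for c by measurable
  let ?g = "\<lambda>n y :: 'a. ennreal ((2 ^ Suc n * a)\<^sup>2) * indicator {y. norm y > 2 ^ n * a} y"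
  have bound: "ennreal ((norm y)\<^sup>2) \<le> ennreal (a\<^sup>2) + (\<Sum>n. ?g n y)" for y :: 'a
  proof (cases "norm y \<le> a")
    case True
    then have "ennreal ((norm y)\<^sup>2) \<le> ennreal (a\<^sup>2)" by (intro ennreal_leI power_mono) auto
    then show ?thesis by (simp add: add_increasing2)
  next
    case False
    obtain N where N: "norm y / a < 2 ^ N" using real_arch_pow[of 2 "norm y / a"] by auto
    define m where "m = (LEAST n. norm y \<le> 2 ^ n * a)"
    have ex: "norm y \<le> 2 ^ N * a" using N a by (simp add: field_simps)
    have m: "norm y \<le> 2 ^ m * a" unfolding m_def by (rule LeastI[of "\<lambda>n. norm y \<le> 2 ^ n * a", OF ex])
    have "m \<noteq> 0" using m False by (intro notI) simp
    then obtain n where n: "m = Suc n" using not0_implies_Suc by blast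
    have "\<not> norm y \<le> 2 ^ n * a" using not_less_Least[of n "\<lambda>n. norm y \<le> 2 ^ n * a"] n by (simp add: m_def)
    then have "ennreal ((norm y)\<^sup>2) \<le> ?g n y"
      using m n by (auto intro!: ennreal_leI power_mono)
    also have "?g n y = (\<Sum>k\<in>{n}. ?g k y)" by (subst sum.insert) simp_all
    also have "\<dots> \<le> (\<Sum>n. ?g n y)" by (rule sum_le_suminf) auto
    finally show ?thesis by (simp add: add_increasing)
  qed
  have "(\<integral>\<^sup>+y. ennreal (norm ((norm y)\<^sup>2)) \<partial>M) \<le> (\<integral>\<^sup>+y. ennreal (a\<^sup>2) + (\<Sum>n. ?g n y) \<partial>M)"
    using bound by (intro nn_integral_mono) simp
  also have "\<dots> = ennreal (a\<^sup>2) * emeasure M (space M) + (\<Sum>n. \<integral>\<^sup>+y. ?g n y \<partial>M)"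
    by (simp add: nn_integral_add nn_integral_suminf)
  also have "\<dots> \<le> ennreal (a\<^sup>2) * emeasure M (space M) + (\<Sum>n. ennreal (4 * a\<^sup>2 * (1 / 2) ^ n))"
  proof (intro add_left_mono suminf_le summableI)
    fix n
    have "(2 ^ Suc n * a)\<^sup>2 * measure M {y. norm y > 2 ^ n * a} \<le> (2 ^ Suc n * a)\<^sup>2 * (1 / 8) ^ n"
      by (intro mult_left_mono tail) simp
    also have "\<dots> = 4 * a\<^sup>2 * (4 ^ n * (1 / 8) ^ n)"
      using power_mult_distrib[of "2 :: real" 2 n] by (simp add: power2_eq_square)
    also have "4 ^ n * (1 / 8) ^ n = (1 / 2 :: real) ^ n"
      by (simp add: power_mult_distrib[symmetric])
    finally have "ennreal ((2 ^ Suc n * a)\<^sup>2 * measure M {y. norm y > 2 ^ n * a}) \<le>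
        ennreal (4 * a\<^sup>2 * (1 / 2) ^ n)" by (rule ennreal_leI)
    then show "(\<integral>\<^sup>+y. ?g n y \<partial>M) \<le> ennreal (4 * a\<^sup>2 * (1 / 2) ^ n)"
      by (simp add: nn_integral_cmult_indicator emeasure_eq_measure ennreal_mult')
  qed
  also have "\<dots> < \<infinity>"
  proof -
    have "summable (\<lambda>n. 4 * a\<^sup>2 * (1 / 2) ^ n)"
      by (intro summable_mult summable_geometric) simp
    then have "(\<Sum>n. ennreal (4 * a\<^sup>2 * (1 / 2) ^ n)) \<noteq> \<top>"
      by (rule ennreal_suminf_neq_top) simp
    moreover have "ennreal (a\<^sup>2) * emeasure M (space M) \<noteq> \<top>"
      using ennreal_mult_eq_top_iff[of "ennreal (a\<^sup>2)"] emeasure_finite[of "space M"] by auto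
    ultimately show ?thesis
      unfolding infinity_ennreal_def less_top[symmetric] by (simp only: ennreal_add_eq_top) simp
  qed
  finally show "(\<integral>\<^sup>+y. ennreal (norm ((norm y)\<^sup>2)) \<partial>M) < \<infinity>" .
qed measurable

text \<open>
  The second-moment part of Fernique's theorem. With \<open>p\<close> the tail of the norm and \<open>s\<close> so large that
  \<open>p s < 1 / 9\<close>, the doubling inequality gives \<open>p (2 * t) \<le> (9 / 8) * (p t)\<^sup>2 \<le> p t / 8\<close> for \<open>t \<ge> 4 * s\<close>.
\<close>

theorem gaussian_integrable_norm_squared:
  fixes \<gamma> :: "'a::{real_normed_vector, second_countable_topology} measure"
  assumes "centered_gaussian \<gamma>"
  shows "integrable \<gamma> (\<lambda>y. (norm y)\<^sup>2)"
proof -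
  have sets [measurable_cong]: "sets \<gamma> = sets borel" and prob: "prob_space \<gamma>"
    using assms by (auto simp: centered_gaussian_def)
  interpret prob_space \<gamma> by fact
  have space: "space \<gamma> = UNIV" using sets_eq_imp_space_eq[OF sets] by simp
  have meas: "{y :: 'a. norm y > c} \<in> sets \<gamma>" for c unfolding sets by measurable
  define p where "p c = measure \<gamma> {y. norm y > c}" for c
  have mono: "p c \<le> p b" if "b \<le> c" for b c
    unfolding p_def using that meas by (intro finite_measure_mono) auto
  have "(\<lambda>n. p (real n)) \<longlonglongrightarrow> measure \<gamma> (\<Inter>n. {y. norm y > real n})"
    unfolding p_def using meas by (intro finite_Lim_measure_decseq) (auto simp: decseq_def)
  also have "(\<Inter>n. {y :: 'a. norm y > real n}) = {}"
    using reals_Archimedean2 by (auto simp: set_eq_iff not_less intro: less_imp_le)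
  finally have "(\<lambda>n. p (real n)) \<longlonglongrightarrow> 0" by simp
  then have "eventually (\<lambda>n. p (real n) < 1 / 9) sequentially"
    by (rule order_tendstoD) simp
  then have "eventually (\<lambda>n. p (real n) < 1 / 9 \<and> n \<ge> 1) sequentially"
    using eventually_ge_at_top by (rule eventually_conj)
  then obtain N where N: "p (real N) < 1 / 9" "N \<ge> 1"
    by (auto dest: eventually_happens)
  define s where "s = real N"
  have s: "s > 0" "p s < 1 / 9" using N by (auto simp: s_def)
  have compl: "measure \<gamma> {y. norm y \<le> s} = 1 - p s"
    using prob_compl[OF meas[of s]] by (simp add: p_def space set_diff_eq not_less)
  have halve: "p (2 * t) \<le> p t / 8" if t: "t \<ge> 4 * s" for t
  proof -
    have pt: "0 \<le> p t" "p t \<le> 1 / 9" using mono[of s t] s t by (auto simp: p_def)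
    have "t \<le> (2 * t - s) / sqrt 2"
    proof -
      \<comment> \<open>Here \<open>4 * s \<le> t\<close> enters: the shift by \<open>s\<close> costs at most a quarter of \<open>t\<close>, and \<open>sqrt 2 \<le> 7 / 4\<close>.\<close>
      have "sqrt 2 * t \<le> (7 / 4) * t"
        using t s by (intro mult_right_mono real_le_lsqrt) (auto simp: power2_eq_square)
      also have "\<dots> \<le> 2 * t - s" using t by simp
      finally show ?thesis by (simp add: field_simps)
    qed
    then have "p ((2 * t - s) / sqrt 2) \<le> p t" by (rule mono)
    then have "(p ((2 * t - s) / sqrt 2))\<^sup>2 \<le> (p t)\<^sup>2" by (intro power_mono) (auto simp: p_def)
    moreover have "(1 - p s) * p (2 * t) \<le> (p ((2 * t - s) / sqrt 2))\<^sup>2"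
      using gaussian_tail_doubling[OF assms, of s "2 * t"] compl by (simp add: p_def)
    moreover have "(8 / 9) * p (2 * t) \<le> (1 - p s) * p (2 * t)"
      using s by (intro mult_right_mono) (auto simp: p_def)
    moreover have "(p t)\<^sup>2 \<le> (1 / 9) * p t"
      unfolding power2_eq_square using pt by (intro mult_right_mono) auto
    ultimately show ?thesis by simp
  qed
  have "p (2 ^ n * (4 * s)) \<le> (1 / 8) ^ n" for n
  proof (induction n)
    case 0
    then show ?case by (simp add: p_def)
  next
    case (Suc n)
    have "1 * (4 * s) \<le> 2 ^ n * (4 * s)" using s by (intro mult_right_mono) auto
    then show ?case using halve[of "2 ^ n * (4 * s)"] Suc by (simp add: mult.assoc)
  qed
  then show ?thesis
    using s by (intro integrable_norm_squared_of_dyadic_tails[where a = "4 * s"])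
      (auto simp: p_def sets finite_measure_axioms)
qed

section \<open>Compactness of the dual ball in mean square\<close>

text \<open>
  Sequential weak-* compactness of the dual ball of a separable space, in the form needed here: a
  diagonal subsequence converges on a countable dense set, and hence everywhere because the
  functionals are 1-Lipschitz.
\<close>

lemma bounded_functionals_subseq_convergent:
  fixes f :: "nat \<Rightarrow> 'a::{real_normed_vector, second_countable_topology} \<Rightarrow>\<^sub>L real"
  assumes f: "\<And>n. norm (f n) \<le> 1"
  obtains k :: "nat \<Rightarrow> nat" where "strict_mono k" "\<And>y. convergent (\<lambda>n. blinfun_apply (f (k n)) y)"
proof -
  obtain D :: "'a set" where D: "countable D" "\<And>S. open S \<Longrightarrow> S \<noteq> {} \<Longrightarrow> \<exists>d\<in>D. d \<in> S"
    using countable_dense_setE by metis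
  have lip: "\<bar>blinfun_apply (f n) y\<bar> \<le> norm y" for n y
    using norm_blinfun[of "f n" y] mult_right_mono[OF f[of n], of "norm y"] by simp
  \<comment> \<open>Dividing by \<open>norm d + 1\<close> makes the family uniformly bounded in \<open>d\<close>, as the diagonal argument expects.\<close>
  define F where "F n d = blinfun_apply (f n) d / (norm d + 1)" for n d
  have "norm (F n d) \<le> 1" for n d
    using lip[of n d] norm_ge_zero[of d] by (simp add: F_def divide_le_eq) linarith
  then obtain k :: "nat \<Rightarrow> nat" where k: "strict_mono k"
    and lim: "\<And>d. d \<in> D \<Longrightarrow> \<exists>l. (\<lambda>n. F (k n) d) \<longlonglongrightarrow> l"
    using function_convergent_subsequence[OF D(1), of F 1] by metis
  have conv: "Cauchy (\<lambda>n. blinfun_apply (f (k n)) d)" if d: "d \<in> D" for d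
  proof -
    obtain l where "(\<lambda>n. F (k n) d) \<longlonglongrightarrow> l" using lim[OF d] by blast
    then have "(\<lambda>n. F (k n) d * (norm d + 1)) \<longlonglongrightarrow> l * (norm d + 1)"
      by (intro tendsto_mult tendsto_const)
    moreover have "norm d + 1 \<noteq> 0" using norm_ge_zero[of d] by linarith
    ultimately have "(\<lambda>n. blinfun_apply (f (k n)) d) \<longlonglongrightarrow> l * (norm d + 1)"
      by (simp add: F_def)
    then show ?thesis by (rule LIMSEQ_imp_Cauchy)
  qed
  have "Cauchy (\<lambda>n. blinfun_apply (f (k n)) y)" for y
  proof (rule metric_CauchyI)
    fix e :: real assume e: "e > 0"
    then obtain d where d: "d \<in> D" "dist y d < e / 3" using D(2)[of "ball y (e/3)"] by auto
    obtain N where N: "\<And>m n. m \<ge> N \<Longrightarrow> n \<ge> N \<Longrightarrow>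
        dist (blinfun_apply (f (k m)) d) (blinfun_apply (f (k n)) d) < e / 3"
      using metric_CauchyD[OF conv[OF d(1)], of "e / 3"] e by auto
    have near: "\<bar>blinfun_apply (f n) y - blinfun_apply (f n) d\<bar> < e / 3" for n
      using lip[of n "y - d"] d(2) by (simp add: blinfun.diff_right dist_norm)
    have "dist (blinfun_apply (f (k m)) y) (blinfun_apply (f (k n)) y) < e"
      if "m \<ge> N" "n \<ge> N" for m n
      using N[OF that] near[of "k m"] near[of "k n"] unfolding dist_real_def by linarith
    then show "\<exists>N. \<forall>m\<ge>N. \<forall>n\<ge>N. dist (blinfun_apply (f (k m)) y) (blinfun_apply (f (k n)) y) < e"
      by blast
  qed
  then show thesis using k by (intro that) (auto simp: Cauchy_convergent_iff)
qed

text \<open>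
  The dual unit ball is totally bounded in \<open>L\<^sup>2\<close>: along a pointwise convergent subsequence the
  differences of consecutive functionals tend to 0 and are dominated by \<open>2 * norm y\<close>. This
  compactness is what makes the series converge.
\<close>

lemma unit_functionals_not_L2_separated:
  fixes M :: "'a::{real_normed_vector, second_countable_topology} measure"
    and f :: "nat \<Rightarrow> 'a \<Rightarrow>\<^sub>L real"
  assumes [measurable_cong]: "sets M = sets borel" and int: "integrable M (\<lambda>y. (norm y)\<^sup>2)"
    and f: "\<And>n. norm (f n) \<le> 1" and e: "e > 0"
  shows "\<exists>n m. n < m \<and> (\<integral>y. (blinfun_apply (f m - f n) y)\<^sup>2 \<partial>M) < e"
proof -
  obtain k :: "nat \<Rightarrow> nat" where k: "strict_mono k"
    and conv: "\<And>y. convergent (\<lambda>n. blinfun_apply (f (k n)) y)"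
    using bounded_functionals_subseq_convergent[of f] f by metis
  define D where "D n = f (k (Suc n)) - f (k n)" for n
  have "norm (D n) \<le> 2" for n
    unfolding D_def using norm_triangle_ineq4[of "f (k (Suc n))" "f (k n)"] f[of "k n"] f[of "k (Suc n)"] by linarith
  then have "\<bar>blinfun_apply (D n) y\<bar> \<le> 2 * norm y" for n y
    using norm_blinfun[of "D n" y] mult_right_mono[of "norm (D n)" 2 "norm y"] by force
  then have "(blinfun_apply (D n) y)\<^sup>2 \<le> (2 * norm y)\<^sup>2" for n y
    by (intro power2_le_iff_abs_le[THEN iffD2]) auto
  then have bound: "norm ((blinfun_apply (D n) y)\<^sup>2) \<le> 4 * (norm y)\<^sup>2" for n y
    by (simp add: power_mult_distrib)
  have "(\<lambda>n. (blinfun_apply (D n) y)\<^sup>2) \<longlonglongrightarrow> 0" for y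
  proof -
    obtain l where l: "(\<lambda>n. blinfun_apply (f (k n)) y) \<longlonglongrightarrow> l" using conv[of y] by (auto simp: convergent_def)
    have "(\<lambda>n. (blinfun_apply (f (k (Suc n))) y - blinfun_apply (f (k n)) y)\<^sup>2) \<longlonglongrightarrow> (l - l)\<^sup>2"
      by (intro tendsto_power tendsto_diff l LIMSEQ_Suc[OF l])
    then show ?thesis by (simp add: D_def blinfun.diff_left)
  qed
  then have "(\<lambda>n. \<integral>y. (blinfun_apply (D n) y)\<^sup>2 \<partial>M) \<longlonglongrightarrow> (\<integral>y. 0 \<partial>M)"
    using int bound by (intro integral_dominated_convergence[where w = "\<lambda>y. 4 * (norm y)\<^sup>2"]) auto
  then have "eventually (\<lambda>n. (\<integral>y. (blinfun_apply (D n) y)\<^sup>2 \<partial>M) < e) sequentially"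
    using e by (intro order_tendstoD(2)) auto
  then obtain n where "(\<integral>y. (blinfun_apply (D n) y)\<^sup>2 \<partial>M) < e" by (auto dest: eventually_happens)
  moreover have "k n < k (Suc n)" using k by (simp add: strict_mono_def)
  ultimately show ?thesis unfolding D_def by blast
qed

section \<open>Covariance operators and their deflation\<close>

lemma integrable_functional_scaleR:
  fixes M :: "'a::{banach, second_countable_topology} measure" and f :: "'a \<Rightarrow>\<^sub>L real"
  assumes [measurable_cong]: "sets M = sets borel" and int: "integrable M (\<lambda>y. (norm y)\<^sup>2)"
  shows "integrable M (\<lambda>y. blinfun_apply f y *\<^sub>R y)"
proof (rule Bochner_Integration.integrable_bound[OF integrable_mult_right[OF int, of "norm f"]])
  have "(\<lambda>y. blinfun_apply f y *\<^sub>R y) \<in> borel_measurable borel"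
    by (intro borel_measurable_continuous_onI continuous_intros)
  then show "(\<lambda>y. blinfun_apply f y *\<^sub>R y) \<in> borel_measurable M" by simp
  have "norm (blinfun_apply f y *\<^sub>R y) \<le> norm f * (norm y)\<^sup>2" for y
    using mult_right_mono[OF norm_blinfun[of f y], of "norm y"] by (simp add: power2_eq_square mult.assoc)
  then show "AE y in M. norm (blinfun_apply f y *\<^sub>R y) \<le> norm (norm f * (norm y)\<^sup>2)" by simp
qed

lemma covariance_operator_pairing:
  fixes M :: "'a::{banach, second_countable_topology} measure"
  assumes "sets M = sets borel" "integrable M (\<lambda>y. (norm y)\<^sup>2)"
  shows "blinfun_apply g (blinfun_apply (covariance_operator M) f) =
    (\<integral>y. blinfun_apply f y * blinfun_apply g y \<partial>M)"
  using integral_bounded_linear[OF blinfun.bounded_linear_right integrable_functional_scaleR[OF assms], of g f]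
  by (simp add: covariance_operator_apply[OF assms] blinfun.scaleR_right)

lemma covariance_operator_commute:
  fixes M :: "'a::{banach, second_countable_topology} measure"
  assumes "sets M = sets borel" "integrable M (\<lambda>y. (norm y)\<^sup>2)"
  shows "blinfun_apply g (blinfun_apply (covariance_operator M) f) =
    blinfun_apply f (blinfun_apply (covariance_operator M) g)"
  by (simp add: covariance_operator_pairing[OF assms] mult.commute)

text \<open>
  The covariance form is symmetric and positive semidefinite. So
  \<open>2 * (g, R h) \<le> (g, R g) + (h, R h)\<close>, and the bilinear form is bounded on the unit ball by the
  maximum of the quadratic form; norming functionals turn this bound into one on \<open>norm (R h)\<close>.
\<close>

lemma norm_covariance_operator_eqI:
  fixes M :: "'a::{banach, second_countable_topology} measure"
  assumes M: "sets M = sets borel" "integrable M (\<lambda>y. (norm y)\<^sup>2)"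
    and max: "\<And>g. norm g \<le> 1 \<Longrightarrow> blinfun_apply g (blinfun_apply (covariance_operator M) g) \<le> c"
    and f: "norm f = 1" "blinfun_apply f (blinfun_apply (covariance_operator M) f) = c"
  shows "norm (covariance_operator M) = c"
proof (rule antisym)
  let ?R = "blinfun_apply (covariance_operator M)"
  have nonneg: "0 \<le> blinfun_apply g (?R g)" for g
    unfolding covariance_operator_pairing[OF M] by (intro Bochner_Integration.integral_nonneg) simp
  have polar: "blinfun_apply g (?R h) \<le> c" if "norm g \<le> 1" "norm h \<le> 1" for g h
  proof -
    have "blinfun_apply (g - h) (?R (g - h)) =
        blinfun_apply g (?R g) + blinfun_apply h (?R h) - 2 * blinfun_apply g (?R h)"
      using covariance_operator_commute[OF M, of g h]
      by (simp add: blinfun.diff_left blinfun.diff_right)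
    then show ?thesis using nonneg[of "g - h"] max[OF that(1)] max[OF that(2)] by linarith
  qed
  have "c \<ge> 0" using nonneg[of f] f by simp
  then show "norm (covariance_operator M) \<le> c"
  proof (rule norm_blinfun_bound)
    fix h :: "'a \<Rightarrow>\<^sub>L real"
    obtain g :: "'a \<Rightarrow>\<^sub>L real" where g: "norm g \<le> 1" "blinfun_apply g (?R h) = norm (?R h)"
      by (rule ex_norming_functional)
    show "norm (?R h) \<le> c * norm h"
    proof (cases "h = 0")
      case False
      then have "blinfun_apply g (?R ((1 / norm h) *\<^sub>R h)) \<le> c" by (intro polar g) simp
      then show ?thesis using g(2) False by (simp add: blinfun.scaleR_right field_simps)
    qed simp
  qed
  have "c \<le> norm (?R f)"
    using norm_blinfun[of f "?R f"] f by simp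
  also have "\<dots> \<le> norm (covariance_operator M)"
    using norm_blinfun[of "covariance_operator M" f] f by simp
  finally show "c \<le> norm (covariance_operator M)" .
qed

text \<open>
  Expanding \<open>g (T y) *\<^sub>R T y\<close> for \<open>T y = y - f y *\<^sub>R x\<close> gives, after integration,
  \<open>R g - f (R g) *\<^sub>R x - g x *\<^sub>R R f + (g x * f (R f)) *\<^sub>R x\<close>. The last two terms cancel because
  \<open>R f = c *\<^sub>R x\<close> and \<open>f (R f) = c\<close>, and \<open>f (R g) = g (R f) = c * g x\<close>.
\<close>

lemma covariance_operator_deflate:
  fixes M :: "'a::{banach, second_countable_topology} measure"
  assumes M: "sets M = sets borel" "integrable M (\<lambda>y. (norm y)\<^sup>2)"
    and f: "blinfun_apply (covariance_operator M) f = c *\<^sub>R x"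
      "blinfun_apply f (blinfun_apply (covariance_operator M) f) = c"
    and N: "N = distr M borel (\<lambda>y. y - blinfun_apply f y *\<^sub>R x)"
  shows "sets N = sets borel" "integrable N (\<lambda>y. (norm y)\<^sup>2)"
    "covariance_operator N = covariance_operator M - c *\<^sub>R rank_one_operator x"
proof -
  note [measurable_cong] = M(1)
  let ?T = "\<lambda>y. y - blinfun_apply f y *\<^sub>R x"
  have T [measurable]: "?T \<in> borel_measurable borel"
    by (intro borel_measurable_continuous_onI continuous_intros)
  show sets: "sets N = sets borel" by (simp add: N)
  have "integrable M (\<lambda>y. (norm (?T y))\<^sup>2)"
  proof (rule Bochner_Integration.integrable_bound[OF integrable_mult_right[OF M(2), of "(1 + norm f * norm x)\<^sup>2"]])
    have "norm (?T y) \<le> (1 + norm f * norm x) * norm y" for y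
      using norm_triangle_ineq4[of y "blinfun_apply f y *\<^sub>R x"]
        mult_right_mono[OF norm_blinfun[of f y], of "norm x"] by (simp add: algebra_simps)
    then have "(norm (?T y))\<^sup>2 \<le> (1 + norm f * norm x)\<^sup>2 * (norm y)\<^sup>2" for y
      unfolding power_mult_distrib[symmetric] by (intro power_mono) auto
    then show "AE y in M. norm ((norm (?T y))\<^sup>2) \<le> norm ((1 + norm f * norm x)\<^sup>2 * (norm y)\<^sup>2)" by simp
  qed measurable
  then show int: "integrable N (\<lambda>y. (norm y)\<^sup>2)"
    unfolding N by (subst integrable_distr_eq) auto
  let ?R = "blinfun_apply (covariance_operator M)"
  show "covariance_operator N = covariance_operator M - c *\<^sub>R rank_one_operator x"
  proof (rule blinfun_eqI)
    fix g
    note int_M = integrable_functional_scaleR[OF M]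
    have int_fM: "integrable M (\<lambda>y. blinfun_apply h y * blinfun_apply f y)" for h
      using integrable_bounded_linear[OF blinfun.bounded_linear_right int_M, of f h]
      by (simp add: blinfun.scaleR_right)
    have fg: "blinfun_apply f (?R g) = c * blinfun_apply g x"
      unfolding covariance_operator_commute[OF M, of f g] f(1) by (simp add: blinfun.scaleR_right)
    have [measurable]: "(\<lambda>y. blinfun_apply g y *\<^sub>R y) \<in> borel_measurable borel"
      by (intro borel_measurable_continuous_onI continuous_intros)
    have "blinfun_apply (covariance_operator N) g = (\<integral>y. blinfun_apply g y *\<^sub>R y \<partial>N)"
      by (rule covariance_operator_apply[OF sets int])
    also have "\<dots> = (\<integral>y. blinfun_apply g (?T y) *\<^sub>R ?T y \<partial>M)"
      unfolding N by (rule integral_distr) auto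
    also have "\<dots> = (\<integral>y. blinfun_apply g y *\<^sub>R y - (blinfun_apply g y * blinfun_apply f y) *\<^sub>R x
        - (blinfun_apply g x *\<^sub>R (blinfun_apply f y *\<^sub>R y)
        - (blinfun_apply g x * (blinfun_apply f y * blinfun_apply f y)) *\<^sub>R x) \<partial>M)"
      by (simp add: blinfun.diff_right blinfun.scaleR_right algebra_simps)
    also have "\<dots> = ?R g - blinfun_apply f (?R g) *\<^sub>R x - (blinfun_apply g x *\<^sub>R ?R f
        - (blinfun_apply g x * blinfun_apply f (?R f)) *\<^sub>R x)"
      by (simp add: int_M int_fM del: scaleR_scaleR
          flip: covariance_operator_apply[OF M] covariance_operator_pairing[OF M])
    also have "\<dots> = ?R g - (c * blinfun_apply g x) *\<^sub>R x"
      by (simp add: fg f(1) f(2)[unfolded f(1)])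
    finally show "blinfun_apply (covariance_operator N) g =
        blinfun_apply (covariance_operator M - c *\<^sub>R rank_one_operator x) g"
      by (simp add: blinfun.diff_left blinfun.scaleR_left)
  qed
qed

section \<open>Convergence of the decomposition\<close>

theorem corollary3p7:
  fixes \<gamma> :: "'a::{banach, second_countable_topology} measure"
    and H :: "'a set" and ip :: "'a \<Rightarrow> 'a \<Rightarrow> real"
    and \<Gamma> :: "nat \<Rightarrow> 'a measure" and l :: "nat \<Rightarrow> real"
    and f :: "nat \<Rightarrow> 'a \<Rightarrow>\<^sub>L real" and x :: "nat \<Rightarrow> 'a"
  assumes "centered_gaussian \<gamma>"
    and "cameron_martin_space \<gamma> H ip"
    and "\<not> (\<exists>B. finite B \<and> H \<subseteq> span B)"
    and "iterative_decomposition \<gamma> \<Gamma> l f x"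
  shows "(\<lambda>n. l n *\<^sub>R rank_one_operator (x n)) sums covariance_operator \<gamma> \<and>
    (\<forall>n. norm (covariance_operator \<gamma> - (\<Sum>k\<le>n. l k *\<^sub>R rank_one_operator (x k))) = l (Suc n))"
proof -
  define R where "R n = covariance_operator (\<Gamma> n)" for n
  have \<Gamma>0: "\<Gamma> 0 = \<gamma>"
    and max: "\<And>n g. norm g \<le> 1 \<Longrightarrow> blinfun_apply g (blinfun_apply (R n) g) \<le> l n"
    and f: "\<And>n. norm (f n) = 1" "\<And>n. blinfun_apply (f n) (blinfun_apply (R n) (f n)) = l n"
    and Rf: "\<And>n. blinfun_apply (R n) (f n) = l n *\<^sub>R x n"
    and \<Gamma>_Suc: "\<And>n. \<Gamma> (Suc n) = distr (\<Gamma> n) borel (\<lambda>y. y - blinfun_apply (f n) y *\<^sub>R x n)"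
    using assms(4) unfolding iterative_decomposition_def R_def Ball_def mem_cball_0 by blast+
  have \<Gamma>: "sets (\<Gamma> n) = sets borel \<and> integrable (\<Gamma> n) (\<lambda>y. (norm y)\<^sup>2)" for n
  proof (induction n)
    case 0
    then show ?case
      using assms(1) gaussian_integrable_norm_squared[OF assms(1)] by (simp add: \<Gamma>0 centered_gaussian_def)
  next
    case (Suc n)
    then show ?case
      using covariance_operator_deflate(1,2)[OF _ _ Rf[unfolded R_def] f(2)[unfolded R_def] \<Gamma>_Suc] by blast
  qed
  then have sets: "sets (\<Gamma> n) = sets borel" and int: "integrable (\<Gamma> n) (\<lambda>y. (norm y)\<^sup>2)" for n by auto
  have R_Suc: "R (Suc n) = R n - l n *\<^sub>R rank_one_operator (x n)" for n
    unfolding R_def by (rule covariance_operator_deflate(3)[OF sets int Rf[unfolded R_def] f(2)[unfolded R_def] \<Gamma>_Suc])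
  have commute: "blinfun_apply g (blinfun_apply (R n) h) = blinfun_apply h (blinfun_apply (R n) g)" for g h n
    unfolding R_def by (rule covariance_operator_commute[OF sets int])
  have norm_R: "norm (R n) = l n" for n
    unfolding R_def using max f
    by (intro norm_covariance_operator_eqI[OF sets int, where f = "f n"]) (auto simp: R_def)
  have l_nonneg: "0 \<le> l n" for n using norm_R[of n] norm_ge_zero[of "R n"] by simp
  have remainder: "covariance_operator \<gamma> - (\<Sum>k<n. l k *\<^sub>R rank_one_operator (x k)) = R n" for n
    by (induction n) (simp_all add: R_def \<Gamma>0 flip: R_Suc[unfolded R_def], simp add: R_Suc[unfolded R_def] algebra_simps)
  have form_Suc: "blinfun_apply g (blinfun_apply (R (Suc n)) g) \<le> blinfun_apply g (blinfun_apply (R n) g)" for g n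
    using l_nonneg[of n] by (simp add: R_Suc blinfun.diff_left blinfun.diff_right blinfun.scaleR_left blinfun.scaleR_right mult.assoc)
  have form_le: "blinfun_apply g (blinfun_apply (R n) g) \<le> blinfun_apply g (blinfun_apply (R 0) g)" for g n
    using lift_Suc_antimono_le[of "\<lambda>n. blinfun_apply g (blinfun_apply (R n) g)" 0 n] form_Suc by simp
  have "l (Suc n) \<le> l n" for n
    using form_Suc[of "f (Suc n)" n] max[of "f (Suc n)" n] f[of "Suc n"] by simp
  then have l_antimono: "l n \<le> l m" if "m \<le> n" for m n
    using lift_Suc_antimono_le[of l] that by blast
  \<comment> \<open>Each \<open>f n\<close> is annihilated by all later operators: step \<open>n\<close> removes it, and a later step \<open>m\<close>
      subtracts a multiple of \<open>x m\<close> with coefficient \<open>f n (R m (f m)) = f m (R m (f n)) = 0\<close>.\<close>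
  have R_f_Suc: "blinfun_apply (R (Suc n + j)) (f n) = 0" for n j
  proof (induction j)
    case 0
    have "l n * blinfun_apply (f n) (x n) = l n"
      using f(2)[of n] by (simp add: Rf blinfun.scaleR_right)
    then show ?case by (simp add: R_Suc blinfun.diff_left blinfun.scaleR_left Rf)
  next
    case (Suc j)
    let ?m = "Suc n + j"
    have "l ?m * blinfun_apply (f n) (x ?m) = blinfun_apply (f n) (blinfun_apply (R ?m) (f ?m))"
      by (simp only: Rf blinfun.scaleR_right real_scaleR_def)
    also have "\<dots> = 0" unfolding commute[of "f n"] Suc by simp
    finally show ?case using Suc by (auto simp: R_Suc[of "Suc (n + j)"] blinfun.diff_left blinfun.scaleR_left)
  qed
  \<comment> \<open>Subtracting \<open>f n\<close> does not change \<open>(f m, R m (f m))\<close>, and passing from \<open>R m\<close> back to \<open>R 0\<close>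
      only increases the form. So \<open>l m\<close> bounds \<open>L\<^sup>2\<close>-distances from below.\<close>
  have separated: "l m \<le> (\<integral>y. (blinfun_apply (f m - f n) y)\<^sup>2 \<partial>\<gamma>)" if "n < m" for m n
  proof -
    have "blinfun_apply (R m) (f n) = 0" using R_f_Suc[of n "m - Suc n"] that by simp
    then have "l m = blinfun_apply (f m - f n) (blinfun_apply (R m) (f m - f n))"
      using commute[of "f n" m "f m"] by (simp add: f blinfun.diff_left blinfun.diff_right)
    also have "\<dots> \<le> blinfun_apply (f m - f n) (blinfun_apply (R 0) (f m - f n))" by (rule form_le)
    also have "\<dots> = (\<integral>y. (blinfun_apply (f m - f n) y)\<^sup>2 \<partial>\<gamma>)"
      using covariance_operator_pairing[OF sets int, of "f m - f n" 0 "f m - f n"]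
      by (simp add: R_def \<Gamma>0 power2_eq_square)
    finally show ?thesis .
  qed
  have l_lim: "l \<longlonglongrightarrow> 0"
  proof (rule LIMSEQ_I)
    fix e :: real assume "e > 0"
    then obtain n m where "n < m" "(\<integral>y. (blinfun_apply (f m - f n) y)\<^sup>2 \<partial>\<gamma>) < e"
      using unit_functionals_not_L2_separated[of \<gamma> f e] sets[of 0] int[of 0] f(1) \<Gamma>0 by auto
    then have "l m < e" using separated by fastforce
    then have "norm (l k - 0) < e" if "k \<ge> m" for k
      using l_antimono[OF that] l_nonneg[of k] by simp
    then show "\<exists>m. \<forall>k\<ge>m. norm (l k - 0) < e" by blast
  qed
  have "(\<lambda>n. norm (covariance_operator \<gamma> - (\<Sum>k<n. l k *\<^sub>R rank_one_operator (x k)))) \<longlonglongrightarrow> 0"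
    unfolding remainder norm_R by (rule l_lim)
  then have "(\<lambda>n. covariance_operator \<gamma> - (\<Sum>k<n. l k *\<^sub>R rank_one_operator (x k))) \<longlonglongrightarrow> 0"
    by (rule tendsto_norm_zero_cancel)
  then have "(\<lambda>n. covariance_operator \<gamma> - (covariance_operator \<gamma> - (\<Sum>k<n. l k *\<^sub>R rank_one_operator (x k))))
      \<longlonglongrightarrow> covariance_operator \<gamma> - 0"
    by (intro tendsto_diff tendsto_const)
  then have "(\<lambda>n. l n *\<^sub>R rank_one_operator (x n)) sums covariance_operator \<gamma>"
    by (simp add: sums_def)
  moreover have "norm (covariance_operator \<gamma> - (\<Sum>k\<le>n. l k *\<^sub>R rank_one_operator (x k))) = l (Suc n)" for n
    unfolding lessThan_Suc_atMost[symmetric] remainder norm_R ..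
  ultimately show ?thesis by blast
qed

end
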